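(* Let $n \geq 1$, let $1 \leq p < 2$ and let $f \in L^p(\mathbb{R}^n) \cap L^2(\mathbb{R}^n)$. Define $h_f:\mathbb{R}_{\geq 0} \rightarrow \mathbb{R}_{\geq 0}$ by $$ h_f(x) = \left(8 \int_{\{\xi \in \mathbb{R}^n:\, |\widehat{f}(\xi)| \leq 10x\}} |\widehat{f}(\xi)|^2 \, d\xi\right)^{1/2} + \begin{cases} x & \text{if } p>1, \\ 0 & \text{if } p=1.\end{cases}$$ Then, for all $g \in L^1(\mathbb{R}^n) \cap L^2(\mathbb{R}^n)$, $$ \| f-g\|_{L^2(\mathbb{R}^n)} \leq 2 \cdot \big\| |\widehat{f}| - |\widehat{g}| \big\|_{L^2(\mathbb{R}^n)} + h_f\left( \|f-g\|_{L^p(\mathbb{R}^n)}\right) + 2 \left\| \operatorname{Im}\left( \overline{\widehat{f}}\, |\widehat{f}|^{-1}\, \widehat{g} \right) \right\|_{L^2(\mathbb{R}^n)}.$$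
   Context: Functions are complex-valued. The Fourier transform is normalized as $\widehat{f}(\xi) = \int_{\mathbb{R}^n} f(x) e^{-2\pi i x\cdot \xi}\,dx$ (extended to $L^2(\mathbb{R}^n)$ as usual), so that $\|\widehat{f}\|_{L^2} = \|f\|_{L^2}$ and $\|\widehat{f}\|_{L^{p/(p-1)}} \leq \|f\|_{L^p}$ for $1 \leq p \leq 2$. The function $\operatorname{Im}(\overline{\widehat{f}}\,|\widehat{f}|^{-1}\,\widehat{g})$ denotes $\xi \mapsto \operatorname{Im}\big(\overline{\widehat{f}(\xi)}\,\widehat{g}(\xi)/|\widehat{f}(\xi)|\big)$ where $\widehat{f}(\xi) \neq 0$, and is taken to be $0$ where $\widehat{f}(\xi) = 0$. *)

theory Defs
  imports "HOL-Analysis.Analysis"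
begin

definition Lp_fun :: "real \<Rightarrow> (real ^ 'n \<Rightarrow> complex) \<Rightarrow> bool" where
  "Lp_fun p f \<longleftrightarrow>
     f \<in> borel_measurable lebesgue \<and> integrable lebesgue (\<lambda>x. norm (f x) powr p)"

text \<open>
  The Bochner integral makes this norm 0, not infinite, on measurable functions outside
  $L^p$, so it is meaningful only together with \<^const>\<open>Lp_fun\<close>. Real-valued functions are
  measured through their embedding into \<^typ>\<open>complex\<close>.
\<close>

definition Lp_norm :: "real \<Rightarrow> (real ^ 'n \<Rightarrow> complex) \<Rightarrow> real" where
  "Lp_norm p f = (LINT x|lebesgue. norm (f x) powr p) powr (1 / p)"

definition fourier_integral :: "(real ^ 'n \<Rightarrow> complex) \<Rightarrow> real ^ 'n \<Rightarrow> complex" where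
  "fourier_integral f \<xi> =
     (LINT x|lebesgue. f x * exp (- (2 * complex_of_real pi * \<i> * complex_of_real (x \<bullet> \<xi>))))"

text \<open>
  The extension to $L^2$ by continuity: \<open>F\<close> is the $L^2$-limit of the Fourier integrals of
  some sequence in $L^1 \cap L^2$ that converges to \<open>f\<close> in $L^2$. By Plancherel's theorem
  such an \<open>F\<close> exists for every \<open>f\<close> in $L^2$ and is unique up to null sets.
\<close>

definition is_fourier_L2 :: "(real ^ 'n \<Rightarrow> complex) \<Rightarrow> (real ^ 'n \<Rightarrow> complex) \<Rightarrow> bool" where
  "is_fourier_L2 f F \<longleftrightarrow>
     Lp_fun 2 f \<and> Lp_fun 2 F \<and>
     (\<exists>\<phi>. (\<forall>k::nat. Lp_fun 1 (\<phi> k) \<and> Lp_fun 2 (\<phi> k)) \<and>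
          (\<lambda>k. Lp_norm 2 (\<lambda>x. \<phi> k x - f x)) \<longlonglongrightarrow> 0 \<and>
          (\<lambda>k. Lp_norm 2 (\<lambda>\<xi>. fourier_integral (\<phi> k) \<xi> - F \<xi>)) \<longlonglongrightarrow> 0)"

text \<open>
  Outside $L^1$ the choice operator picks a representative of the almost-everywhere class;
  the value is unspecified outside $L^1 \cup L^2$.
\<close>

definition fourier :: "(real ^ 'n \<Rightarrow> complex) \<Rightarrow> real ^ 'n \<Rightarrow> complex" where
  "fourier f = (if Lp_fun 1 f then fourier_integral f else (SOME F. is_fourier_L2 f F))"

definition h_fun :: "real \<Rightarrow> (real ^ 'n \<Rightarrow> complex) \<Rightarrow> real \<Rightarrow> real" where
  "h_fun p f x =
     sqrt (8 * (LINT \<xi>:{\<xi>. norm (fourier f \<xi>) \<le> 10 * x}|lebesgue. (norm (fourier f \<xi>))\<^sup>2))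
     + (if p > 1 then x else 0)"

definition Im_part :: "(real ^ 'n \<Rightarrow> complex) \<Rightarrow> (real ^ 'n \<Rightarrow> complex) \<Rightarrow> real ^ 'n \<Rightarrow> real" where
  "Im_part F G \<xi> =
     (if F \<xi> = 0 then 0 else Im (cnj (F \<xi>) * G \<xi> / complex_of_real (norm (F \<xi>))))"

end

theory Submission
  imports Defs "HOL-Probability.Probability" "HOL-Complex_Analysis.Complex_Analysis"
begin

text \<open>
  Write $F$ and $G$ for the transforms of $f$ and $g$, put $H = F - G$ and
  $e = \|f - g\|_{L^p}$. By Plancherel's theorem the claim is a bound for $\|H\|_{L^2}$, and it
  follows from a pointwise bound and Minkowski's inequality
  (\<open>pointwise_decomposition\<close>, \<open>norm2_add_bound\<close>). Every frequency is of one of three kinds.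

  \<^item> $|F| \le 10 e$: then $|H| \le 2|F| + \bigl||F| - |G|\bigr|$, and $2 \le \sqrt 8$.
  \<^item> $|F| > 10 e$ and $|H| \le e$: after rotation by the phase of $F$, the number $G$ becomes $a + i b$
    with $b$ the imaginary part in the statement, and $a \ge 0$ because $H$ is small against $F$.
    Hence $|G|$ differs from $a$ by at most $|b|$, and $|H| \le \bigl||F| - |G|\bigr| + 2|b|$.
  \<^item> $|H| > e$: this set is empty when $p = 1$. When $p > 1$, the $L^2$ norm of $H$ over it is at
    most $e$ (\<open>weak_hausdorff_young\<close>), which is the summand $x$ of $h_f$.

  The last bound would follow from the Hausdorff--Young inequality with constant $1$. It is derived
  from the bilinear form of that inequality, $|\int \hat u v| \le \|u\|_p \|v\|_p$
  (\<open>hausdorff_young_pairing\<close>), tested on the conjugate of $\hat u$ cut off to the set where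
  $|\hat u| > \|u\|_p$. The bilinear form is Riesz--Thorin
  interpolation between $L^1 \to L^\infty$ and $L^2 \to L^2$. For simple functions the analytic
  family in its proof is a finite sum of exponentials, so the three lines theorem applies to an
  entire function (\<open>riesz_thorin_simple\<close>); dominated convergence then removes simplicity.

  Plancherel's theorem is proved on $L^1 \cap L^2$ by Gaussian summation. The function $|\hat f|^2$
  is the transform of the autocorrelation $R$ of $f$, so its integral against a Gaussian weight
  is a Gaussian average of $R$ near $0$ (\<open>integral_norm_ft_gauss\<close>). Since
  $|R| \le R(0) = \|f\|_2^2$, this yields $\|\hat f\|_2 \le \|f\|_2$ in general, and equality if $R$ is
  continuous at $0$, in particular if $f$ is also bounded and continuous. Given the inequality, the
  functions with equality are closed under sums and $L^2$ limits, and this reaches all of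
  $L^1 \cap L^2$ (\<open>norm2_ft\<close>). Completeness of $L^2$ provides the transform of every
  square-integrable function.
\<close>

section \<open>Square-integrable functions\<close>

definition square_integrable :: "'a measure \<Rightarrow> ('a \<Rightarrow> complex) \<Rightarrow> bool" where
  "square_integrable M f \<longleftrightarrow> f \<in> borel_measurable M \<and> integrable M (\<lambda>x. (cmod (f x))\<^sup>2)"

definition norm2 :: "'a measure \<Rightarrow> ('a \<Rightarrow> complex) \<Rightarrow> real" where
  "norm2 M f = sqrt (LINT x|M. (cmod (f x))\<^sup>2)"

lemma square_integrable_measurable [measurable_dest]:
  "square_integrable M f \<Longrightarrow> f \<in> borel_measurable M"
  by (simp add: square_integrable_def)

lemma square_integrableD: "square_integrable M f \<Longrightarrow> integrable M (\<lambda>x. (cmod (f x))\<^sup>2)"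
  by (simp add: square_integrable_def)

lemma norm2_nonneg [simp]: "0 \<le> norm2 M f"
  by (simp add: norm2_def)

lemma norm2_squared: "(norm2 M f)\<^sup>2 = (LINT x|M. (cmod (f x))\<^sup>2)"
  by (simp add: norm2_def)

lemma square_integrable_mono:
  assumes f: "f \<in> borel_measurable M" and g: "square_integrable M g"
    and le: "\<And>x. x \<in> space M \<Longrightarrow> cmod (f x) \<le> C * cmod (g x)" and C: "0 \<le> C"
  shows "square_integrable M f" "norm2 M f \<le> C * norm2 M g"
proof -
  have le2: "(cmod (f x))\<^sup>2 \<le> C\<^sup>2 * (cmod (g x))\<^sup>2" if "x \<in> space M" for x
    using power_mono[OF le[OF that], of 2] by (simp add: power_mult_distrib)
  have gi: "integrable M (\<lambda>x. C\<^sup>2 * (cmod (g x))\<^sup>2)"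
    using square_integrableD[OF g] by simp
  have fi: "integrable M (\<lambda>x. (cmod (f x))\<^sup>2)"
    by (rule Bochner_Integration.integrable_bound[OF gi]) (use f le2 in auto)
  then show "square_integrable M f" using f by (simp add: square_integrable_def)
  have "(norm2 M f)\<^sup>2 \<le> (C * norm2 M g)\<^sup>2"
    unfolding power_mult_distrib norm2_squared
    using integral_mono[OF fi gi le2] by simp
  then show "norm2 M f \<le> C * norm2 M g"
    using C by (auto intro: power2_le_imp_le)
qed

lemma square_integrable_add:
  assumes f: "square_integrable M f" and g: "square_integrable M g"
  shows "square_integrable M (\<lambda>x. f x + g x)"
proof -
  note [measurable] = square_integrable_measurable[OF f] square_integrable_measurable[OF g]
  have le: "(cmod (f x + g x))\<^sup>2 \<le> 2 * (cmod (f x))\<^sup>2 + 2 * (cmod (g x))\<^sup>2" for x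
  proof -
    have "(cmod (f x + g x))\<^sup>2 \<le> (cmod (f x) + cmod (g x))\<^sup>2"
      by (intro power_mono norm_triangle_ineq) auto
    also have "\<dots> \<le> 2 * (cmod (f x))\<^sup>2 + 2 * (cmod (g x))\<^sup>2"
      using sum_squares_bound[of "cmod (f x)" "cmod (g x)"] by (simp add: power2_sum)
    finally show ?thesis .
  qed
  have "integrable M (\<lambda>x. (cmod (f x + g x))\<^sup>2)"
    by (rule Bochner_Integration.integrable_bound[where
          f = "\<lambda>x. 2 * (cmod (f x))\<^sup>2 + 2 * (cmod (g x))\<^sup>2"])
       (use le square_integrableD[OF f] square_integrableD[OF g] in auto)
  then show ?thesis by (simp add: square_integrable_def)
qed

lemma square_integrable_cmult:
  assumes "square_integrable M f"
  shows "square_integrable M (\<lambda>x. c * f x)" "norm2 M (\<lambda>x. c * f x) = cmod c * norm2 M f"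
proof -
  show "square_integrable M (\<lambda>x. c * f x)"
    using assms by (auto simp: square_integrable_def norm_mult power_mult_distrib)
  show "norm2 M (\<lambda>x. c * f x) = cmod c * norm2 M f"
    by (simp add: norm2_def norm_mult power_mult_distrib real_sqrt_mult)
qed

lemma square_integrable_diff:
  assumes f: "square_integrable M f" and g: "square_integrable M g"
  shows "square_integrable M (\<lambda>x. f x - g x)"
  using square_integrable_add[OF f square_integrable_cmult(1)[OF g, of "-1"]] by simp

lemma square_integrable_sum:
  "finite I \<Longrightarrow> (\<And>i. i \<in> I \<Longrightarrow> square_integrable M (f i)) \<Longrightarrow>
    square_integrable M (\<lambda>x. \<Sum>i\<in>I. f i x)"
  by (induction I rule: finite_induct)
     (auto simp: square_integrable_add, simp add: square_integrable_def)

lemma Cauchy_Schwarz_integral: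
  assumes f: "square_integrable M f" and g: "square_integrable M g"
  shows "integrable M (\<lambda>x. f x * g x)"
    and "(LINT x|M. cmod (f x) * cmod (g x)) \<le> norm2 M f * norm2 M g"
    and "cmod (LINT x|M. f x * g x) \<le> norm2 M f * norm2 M g"
proof -
  note [measurable] = square_integrable_measurable[OF f] square_integrable_measurable[OF g]
  have le: "cmod (f x) * cmod (g x) \<le> (cmod (f x))\<^sup>2 + (cmod (g x))\<^sup>2" for x
    using sum_squares_bound[of "cmod (f x)" "cmod (g x)"]
      mult_nonneg_nonneg[of "cmod (f x)" "cmod (g x)"] by (simp del: mult_nonneg_nonneg)
  have "integrable M (\<lambda>x. (cmod (f x))\<^sup>2 + (cmod (g x))\<^sup>2)"
    using square_integrableD[OF f] square_integrableD[OF g] by auto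
  then show i: "integrable M (\<lambda>x. f x * g x)"
    by (rule Bochner_Integration.integrable_bound) (use le in \<open>auto simp: norm_mult\<close>)
  have ii: "integrable M (\<lambda>x. cmod (f x) * cmod (g x))"
    using integrable_norm[OF i] by (simp add: norm_mult)
  have "ennreal ((LINT x|M. cmod (f x) * cmod (g x))\<^sup>2)
      = (\<integral>\<^sup>+x. ennreal (cmod (f x)) * ennreal (cmod (g x)) \<partial>M)\<^sup>2"
    by (simp add: ennreal_power[symmetric] nn_integral_eq_integral[OF ii, symmetric] ennreal_mult)
  also have "\<dots> \<le> (\<integral>\<^sup>+x. (ennreal (cmod (f x)))\<^sup>2 \<partial>M) * (\<integral>\<^sup>+x. (ennreal (cmod (g x)))\<^sup>2 \<partial>M)"
    by (rule Cauchy_Schwarz_nn_integral) auto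
  also have "\<dots> = ennreal ((LINT x|M. (cmod (f x))\<^sup>2) * (LINT x|M. (cmod (g x))\<^sup>2))"
    by (simp add: ennreal_power ennreal_mult nn_integral_eq_integral
        square_integrableD[OF f] square_integrableD[OF g])
  finally have "(LINT x|M. cmod (f x) * cmod (g x))\<^sup>2 \<le> (norm2 M f * norm2 M g)\<^sup>2"
    by (simp add: power_mult_distrib norm2_squared)
  then show "(LINT x|M. cmod (f x) * cmod (g x)) \<le> norm2 M f * norm2 M g"
    by (rule power2_le_imp_le) auto
  then show "cmod (LINT x|M. f x * g x) \<le> norm2 M f * norm2 M g"
    using integral_norm_bound[of M "\<lambda>x. f x * g x"] by (simp add: norm_mult)
qed

lemma norm2_triangle:
  assumes f: "square_integrable M f" and g: "square_integrable M g"
  shows "norm2 M (\<lambda>x. f x + g x) \<le> norm2 M f + norm2 M g"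
proof -
  note [measurable] = square_integrable_measurable[OF f] square_integrable_measurable[OF g]
  have i: "integrable M (\<lambda>x. cmod (f x) * cmod (g x))"
    using integrable_norm[OF Cauchy_Schwarz_integral(1)[OF f g]] by (simp add: norm_mult)
  have "(norm2 M (\<lambda>x. f x + g x))\<^sup>2
      \<le> (LINT x|M. (cmod (f x))\<^sup>2 + (cmod (g x))\<^sup>2 + 2 * (cmod (f x) * cmod (g x)))"
    unfolding norm2_squared
  proof (rule integral_mono)
    show "integrable M (\<lambda>x. (cmod (f x + g x))\<^sup>2)"
      by (rule square_integrableD[OF square_integrable_add[OF f g]])
    show "(cmod (f x + g x))\<^sup>2 \<le> (cmod (f x))\<^sup>2 + (cmod (g x))\<^sup>2 + 2 * (cmod (f x) * cmod (g x))" for x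
      using power_mono[OF norm_triangle_ineq[of "f x" "g x"], of 2] by (simp add: power2_sum)
  qed (use i square_integrableD[OF f] square_integrableD[OF g] in auto)
  also have "\<dots> = (norm2 M f)\<^sup>2 + (norm2 M g)\<^sup>2 + 2 * (LINT x|M. cmod (f x) * cmod (g x))"
    using i square_integrableD[OF f] square_integrableD[OF g] by (simp add: norm2_squared)
  also have "\<dots> \<le> (norm2 M f + norm2 M g)\<^sup>2"
    using Cauchy_Schwarz_integral(2)[OF f g] by (simp add: power2_sum)
  finally show ?thesis by (rule power2_le_imp_le) auto
qed

lemma norm2_diff_commute: "norm2 M (\<lambda>x. f x - g x) = norm2 M (\<lambda>x. g x - f x)"
  by (simp add: norm2_def norm_minus_commute)

lemma norm2_triangle3:
  assumes f: "square_integrable M f" and g: "square_integrable M g" and h: "square_integrable M h"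
  shows "norm2 M (\<lambda>x. f x - h x) \<le> norm2 M (\<lambda>x. f x - g x) + norm2 M (\<lambda>x. g x - h x)"
  using norm2_triangle[OF square_integrable_diff[OF f g] square_integrable_diff[OF g h]] by simp

lemma norm2_abs_diff:
  assumes f: "square_integrable M f" and g: "square_integrable M g"
  shows "\<bar>norm2 M f - norm2 M g\<bar> \<le> norm2 M (\<lambda>x. f x - g x)"
  using norm2_triangle[OF square_integrable_diff[OF f g] g]
    norm2_triangle[OF square_integrable_diff[OF g f] f] norm2_diff_commute[of M f g] by simp

lemma norm2_tendsto:
  assumes f: "\<And>k::nat. square_integrable M (f k)" and g: "square_integrable M g"
    and lim: "(\<lambda>k. norm2 M (\<lambda>x. f k x - g x)) \<longlonglongrightarrow> 0"
  shows "(\<lambda>k. norm2 M (f k)) \<longlonglongrightarrow> norm2 M g"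
proof -
  have "(\<lambda>k. norm2 M (f k) - norm2 M g) \<longlonglongrightarrow> 0"
    by (rule Lim_null_comparison[OF _ lim]) (auto intro!: eventuallyI norm2_abs_diff f g)
  then show ?thesis by (simp add: LIM_zero_iff)
qed

lemma inner2_tendsto:
  assumes f: "\<And>k::nat. square_integrable M (f k)" and F: "square_integrable M F"
    and g: "\<And>k::nat. square_integrable M (g k)" and G: "square_integrable M G"
    and lf: "(\<lambda>k. norm2 M (\<lambda>x. f k x - F x)) \<longlonglongrightarrow> 0"
    and lg: "(\<lambda>k. norm2 M (\<lambda>x. g k x - G x)) \<longlonglongrightarrow> 0"
  shows "(\<lambda>k. LINT x|M. f k x * g k x) \<longlonglongrightarrow> (LINT x|M. F x * G x)"
proof -
  have "cmod ((LINT x|M. f k x * g k x) - (LINT x|M. F x * G x))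
     \<le> norm2 M (\<lambda>x. f k x - F x) * norm2 M (g k) + norm2 M F * norm2 M (\<lambda>x. g k x - G x)" for k
  proof -
    have "(LINT x|M. f k x * g k x) - (LINT x|M. F x * G x)
        = (LINT x|M. (f k x - F x) * g k x + F x * (g k x - G x))"
      by (subst Bochner_Integration.integral_diff[symmetric])
         (auto intro!: Cauchy_Schwarz_integral(1) f g F G Bochner_Integration.integral_cong
            simp: algebra_simps)
    also have "\<dots> = (LINT x|M. (f k x - F x) * g k x) + (LINT x|M. F x * (g k x - G x))"
      by (intro Bochner_Integration.integral_add Cauchy_Schwarz_integral(1)
            square_integrable_diff f g F G)
    also have "cmod \<dots> \<le> norm2 M (\<lambda>x. f k x - F x) * norm2 M (g k)
        + norm2 M F * norm2 M (\<lambda>x. g k x - G x)"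
      by (intro norm_triangle_le add_mono Cauchy_Schwarz_integral(3) square_integrable_diff f g F G)
    finally show ?thesis .
  qed
  note bound = this
  have gl: "(\<lambda>k. norm2 M (g k)) \<longlonglongrightarrow> norm2 M G"
    by (rule norm2_tendsto[OF g G lg])
  have "(\<lambda>k. norm2 M (\<lambda>x. f k x - F x) * norm2 M (g k)
      + norm2 M F * norm2 M (\<lambda>x. g k x - G x)) \<longlonglongrightarrow> 0"
    using tendsto_add[OF tendsto_mult[OF lf gl] tendsto_mult_left[OF lg, of "norm2 M F"]] by simp
  then have "(\<lambda>k. (LINT x|M. f k x * g k x) - (LINT x|M. F x * G x)) \<longlonglongrightarrow> 0"
    by (rule Lim_null_comparison[rotated]) (rule always_eventually, rule allI, rule bound)
  then show ?thesis by (simp add: LIM_zero_iff)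
qed

lemma norm2_dominated_tendsto:
  assumes f: "\<And>k::nat. f k \<in> borel_measurable M" and g: "square_integrable M g"
    and le: "\<And>k x. x \<in> space M \<Longrightarrow> cmod (f k x) \<le> 2 * cmod (g x)"
    and lim: "\<And>x. x \<in> space M \<Longrightarrow> (\<lambda>k. f k x) \<longlonglongrightarrow> g x"
  shows "(\<lambda>k. norm2 M (\<lambda>x. f k x - g x)) \<longlonglongrightarrow> 0"
proof -
  note [measurable] = f square_integrable_measurable[OF g]
  have "(\<lambda>k. LINT x|M. (cmod (f k x - g x))\<^sup>2) \<longlonglongrightarrow> (LINT x|M. 0)"
  proof (rule integral_dominated_convergence[where w = "\<lambda>x. 9 * (cmod (g x))\<^sup>2"])
    show "AE x in M. (\<lambda>k. (cmod (f k x - g x))\<^sup>2) \<longlonglongrightarrow> 0"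
    proof (rule AE_I2)
      fix x assume "x \<in> space M"
      then have "(\<lambda>k. f k x - g x) \<longlonglongrightarrow> 0" using lim by (simp add: LIM_zero_iff)
      then have "(\<lambda>k. (cmod (f k x - g x))\<^sup>2) \<longlonglongrightarrow> (cmod 0)\<^sup>2" by (intro tendsto_intros)
      then show "(\<lambda>k. (cmod (f k x - g x))\<^sup>2) \<longlonglongrightarrow> 0" by simp
    qed
    show "AE x in M. norm ((cmod (f k x - g x))\<^sup>2) \<le> 9 * (cmod (g x))\<^sup>2" for k
    proof (rule AE_I2)
      fix x assume "x \<in> space M"
      then have "cmod (f k x - g x) \<le> 3 * cmod (g x)"
        using norm_triangle_ineq4[of "f k x" "g x"] le[of x k] by simp
      from power_mono[OF this, of 2] show "norm ((cmod (f k x - g x))\<^sup>2) \<le> 9 * (cmod (g x))\<^sup>2"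
        by (simp add: power_mult_distrib)
    qed
  qed (use square_integrableD[OF g] in auto)
  then have "(\<lambda>k. sqrt (LINT x|M. (cmod (f k x - g x))\<^sup>2)) \<longlonglongrightarrow> sqrt 0"
    by (intro tendsto_intros) simp
  then show ?thesis by (simp add: norm2_def)
qed

lemma cnj_measurable [measurable]: "cnj \<in> borel_measurable borel"
  by (intro borel_measurable_continuous_onI continuous_intros)

lemma square_integrable_cnj:
  assumes f: "square_integrable M f"
  shows "square_integrable M (\<lambda>x. cnj (f x))" "norm2 M (\<lambda>x. cnj (f x)) = norm2 M f"
proof -
  note [measurable] = square_integrable_measurable[OF f]
  show "square_integrable M (\<lambda>x. cnj (f x))" "norm2 M (\<lambda>x. cnj (f x)) = norm2 M f"
    using f by (auto simp: square_integrable_def norm2_def)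
qed

text \<open>
  The identity that turns an inequality between two such norms into equality: it is what makes the
  set of functions on which a linear contraction is isometric closed under sums.
\<close>

lemma norm2_parallelogram:
  assumes f: "square_integrable M f" and g: "square_integrable M g"
  shows "(norm2 M (\<lambda>x. f x + g x))\<^sup>2 + (norm2 M (\<lambda>x. f x - g x))\<^sup>2
    = 2 * (norm2 M f)\<^sup>2 + 2 * (norm2 M g)\<^sup>2"
proof -
  have "(cmod (a + b))\<^sup>2 + (cmod (a - b))\<^sup>2 = 2 * (cmod a)\<^sup>2 + 2 * (cmod b)\<^sup>2" for a b
    by (simp add: cmod_power2 power2_sum power2_diff)
  then have "(LINT x|M. (cmod (f x + g x))\<^sup>2 + (cmod (f x - g x))\<^sup>2)
      = (LINT x|M. 2 * (cmod (f x))\<^sup>2 + 2 * (cmod (g x))\<^sup>2)" by simp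
  then show ?thesis
    using square_integrableD[OF f] square_integrableD[OF g]
      square_integrableD[OF square_integrable_add[OF f g]] square_integrableD[OF square_integrable_diff[OF f g]]
    by (simp add: norm2_squared)
qed

lemma norm2_add_bound:
  assumes h: "h \<in> borel_measurable M" and a: "square_integrable M a" and b: "square_integrable M b"
    and le: "\<And>x. cmod (h x) \<le> cmod (a x) + cmod (b x)"
  shows "square_integrable M h" "norm2 M h \<le> norm2 M a + norm2 M b"
proof -
  have *: "square_integrable M (\<lambda>x. complex_of_real (cmod (f x)))"
    "norm2 M (\<lambda>x. complex_of_real (cmod (f x))) = norm2 M f" if "square_integrable M f" for f
    using that by (auto simp: square_integrable_def norm2_def)
  have le': "cmod (h x) \<le> 1 * cmod (complex_of_real (cmod (a x)) + complex_of_real (cmod (b x)))" for x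
    using le[of x] unfolding of_real_add[symmetric] norm_of_real by simp
  note ab = square_integrable_add[OF *(1)[OF a] *(1)[OF b]]
  show "square_integrable M h" by (rule square_integrable_mono(1)[OF h ab le']) simp
  show "norm2 M h \<le> norm2 M a + norm2 M b"
    using square_integrable_mono(2)[OF h ab le'] norm2_triangle[OF *(1)[OF a] *(1)[OF b]]
    by (simp add: *(2) a b)
qed

lemma indicator_square_integrable:
  assumes "A \<in> sets M" "emeasure M A < \<infinity>"
  shows "integrable M (indicator A :: _ \<Rightarrow> complex)" "square_integrable M (indicator A)"
    "(norm2 M (indicator A))\<^sup>2 = measure M A"
proof -
  have eq: "(\<lambda>x. (cmod (indicator A x))\<^sup>2) = indicator A" by (auto simp: indicator_def)
  have i: "integrable M (indicator A :: _ \<Rightarrow> real)" using assms by (simp add: integrable_indicator_iff)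
  have "(\<lambda>x. complex_of_real (indicator A x)) = indicator A" by (auto simp: indicator_def)
  then show "integrable M (indicator A :: _ \<Rightarrow> complex)"
    using integrable_of_real[OF i, where 'a = complex] by simp
  show "square_integrable M (indicator A)"
    unfolding square_integrable_def eq using assms i by simp
  show "(norm2 M (indicator A))\<^sup>2 = measure M A"
    unfolding norm2_squared eq using sets.sets_into_space[OF assms(1)]
    by (simp add: Int_absorb2)
qed

section \<open>Simple approximation and completeness\<close>

lemma simple_function_approx:
  fixes f :: "'a \<Rightarrow> complex"
  assumes "f \<in> borel_measurable M"
  obtains s where "\<And>k::nat. simple_function M (s k)"
    "\<And>x. x \<in> space M \<Longrightarrow> (\<lambda>k. s k x) \<longlonglongrightarrow> f x"
    "\<And>k x. x \<in> space M \<Longrightarrow> cmod (s k x) \<le> 2 * cmod (f x)"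
proof -
  obtain s where "\<forall>i::nat. simple_function M (s i)" "\<forall>x\<in>space M. (\<lambda>i. s i x) \<longlonglongrightarrow> f x"
    "\<forall>i. \<forall>x\<in>space M. dist (s i x) 0 \<le> 2 * dist (f x) 0"
    using borel_measurable_implies_sequence_metric[OF assms, of 0] by blast
  then show ?thesis by (intro that[of s]) auto
qed

lemma simple_function_representation:
  fixes s :: "'a \<Rightarrow> complex"
  assumes "simple_function M s" "x \<in> space M"
  shows "s x = (\<Sum>c\<in>s ` space M. c * indicator {y \<in> space M. s y = c} x)"
proof -
  have "(\<Sum>c\<in>s ` space M. c * indicator {y \<in> space M. s y = c} x)
      = (\<Sum>c\<in>s ` space M. if c = s x then c else 0)"
    using assms(2) by (intro sum.cong) (auto simp: indicator_def)
  also have "\<dots> = s x"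
    using assms simple_functionD(1)[OF assms(1)] by (simp add: sum.delta)
  finally show ?thesis ..
qed

lemma simple_function_level_finite:
  fixes s :: "'a \<Rightarrow> complex"
  assumes s: "simple_function M s" and i: "integrable M s" and c: "c \<noteq> 0"
  shows "{y \<in> space M. s y = c} \<in> sets M" "emeasure M {y \<in> space M. s y = c} < \<infinity>"
proof -
  let ?A = "{y \<in> space M. s y = c}"
  have "s -` {c} \<inter> space M = ?A" by auto
  then show A: "?A \<in> sets M" using simple_functionD(2)[OF s, of "{c}"] by simp
  have "integrable M (indicator ?A :: _ \<Rightarrow> real)"
    by (rule Bochner_Integration.integrable_bound[where f = "\<lambda>x. s x / complex_of_real (cmod c)"])
       (use A i c in \<open>auto simp: indicator_def norm_divide\<close>)
  then show "emeasure M ?A < \<infinity>" by (simp add: integrable_indicator_iff A)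
qed

text \<open>
  Geometric decay of the increments makes the sum of $2^k |F_{k+1} - F_k|^2$ integrable. Wherever that
  sum is finite the increments are absolutely summable, so the sequence converges almost everywhere;
  Fatou's lemma then gives the rate of convergence in norm.
\<close>

lemma norm2_complete:
  assumes F: "\<And>k::nat. square_integrable M (F k)"
    and d: "\<And>k. norm2 M (\<lambda>x. F (Suc k) x - F k x) \<le> (1/2) ^ k"
  obtains G where "square_integrable M G" "(\<lambda>k. norm2 M (\<lambda>x. F k x - G x)) \<longlonglongrightarrow> 0"
proof -
  note [measurable] = square_integrable_measurable[OF F]
  define D where "D k x = F (Suc k) x - F k x" for k x
  have D2: "square_integrable M (D k)" for k
    unfolding D_def by (rule square_integrable_diff[OF F F])
  note [measurable] = square_integrable_measurable[OF D2]
  define G where "G x = lim (\<lambda>k. F k x)" for x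
  have [measurable]: "G \<in> borel_measurable M" unfolding G_def by (rule borel_measurable_lim_metric) measurable
  have "(\<integral>\<^sup>+x. (\<Sum>k. ennreal (2 ^ k * (cmod (D k x))\<^sup>2)) \<partial>M) = (\<Sum>k. \<integral>\<^sup>+x. ennreal (2 ^ k * (cmod (D k x))\<^sup>2) \<partial>M)"
    by (rule nn_integral_suminf) measurable
  also have "\<dots> \<le> (\<Sum>k. ennreal ((1/2) ^ k))"
  proof (rule suminf_le)
    fix k
    have "(\<integral>\<^sup>+x. ennreal (2 ^ k * (cmod (D k x))\<^sup>2) \<partial>M) = ennreal (2 ^ k * (norm2 M (D k))\<^sup>2)"
      unfolding norm2_squared using square_integrableD[OF D2] by (subst nn_integral_eq_integral) auto
    also have "\<dots> \<le> ennreal (2 ^ k * ((1/2) ^ k)\<^sup>2)"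
      using d[of k] by (intro ennreal_leI mult_left_mono power_mono) (auto simp: D_def[abs_def])
    also have "2 ^ k * ((1/2) ^ k)\<^sup>2 = (1/2 :: real) ^ k"
      by (simp add: power2_eq_square power_divide)
    finally show "(\<integral>\<^sup>+x. ennreal (2 ^ k * (cmod (D k x))\<^sup>2) \<partial>M) \<le> ennreal ((1/2) ^ k)" .
  qed auto
  also have "\<dots> < \<infinity>"
    using summable_geometric[of "1/2 :: real"] by (subst suminf_ennreal2) auto
  finally have "AE x in M. (\<Sum>k. ennreal (2 ^ k * (cmod (D k x))\<^sup>2)) \<noteq> \<infinity>"
    by (intro nn_integral_PInf_AE) auto
  then have ae: "AE x in M. (\<lambda>k. F k x) \<longlonglongrightarrow> G x"
  proof eventually_elim
    fix x assume fin: "(\<Sum>k. ennreal (2 ^ k * (cmod (D k x))\<^sup>2)) \<noteq> \<infinity>"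
    have s1: "summable (\<lambda>k. 2 ^ k * (cmod (D k x))\<^sup>2)"
      by (rule summable_suminf_not_top) (use fin in auto)
    have sg: "summable (\<lambda>k. (1/2) ^ k + 2 ^ k * (cmod (D k x))\<^sup>2)"
      by (intro summable_add s1 summable_geometric) auto
    have le: "norm (D k x) \<le> (1/2) ^ k + 2 ^ k * (cmod (D k x))\<^sup>2" for k
    proof -
      \<comment> \<open>Arithmetic--geometric mean inequality, with the weights chosen so that both terms are summable.\<close>
      have "0 \<le> 2 ^ k * (cmod (D k x) - (1/2) ^ k)\<^sup>2" by simp
      also have "\<dots> = 2 ^ k * (cmod (D k x))\<^sup>2 + (1/2) ^ k - 2 * cmod (D k x)"
        by (simp add: power2_diff field_simps power2_eq_square)
      finally show ?thesis using norm_ge_zero[of "D k x"] by linarith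
    qed
    have "summable (\<lambda>k. D k x)" by (rule summable_comparison_test'[OF sg le])
    then have "convergent (\<lambda>n. \<Sum>k<n. D k x)" by (simp add: summable_iff_convergent)
    moreover have "(\<Sum>k<n. D k x) = F n x - F 0 x" for n
      unfolding D_def by (rule sum_lessThan_telescope)
    ultimately have "convergent (\<lambda>n. F n x - F 0 x)" by simp
    then have "convergent (\<lambda>n. F n x)"
      using convergent_diff_const_right_iff by blast
    then show "(\<lambda>k. F k x) \<longlonglongrightarrow> G x" unfolding G_def by (simp add: convergent_LIMSEQ_iff)
  qed
  have dist: "norm2 M (\<lambda>x. F k x - F (k + j) x) \<le> 2 * (1/2) ^ k - 2 * (1/2) ^ (k + j)" for k j
  proof (induction j)
    case 0
    show ?case by (simp add: norm2_def)
  next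
    case (Suc j)
    have "norm2 M (\<lambda>x. F k x - F (k + Suc j) x)
        \<le> norm2 M (\<lambda>x. F k x - F (k + j) x) + norm2 M (\<lambda>x. F (k + j) x - F (k + Suc j) x)"
      by (rule norm2_triangle3[OF F F F])
    also have "norm2 M (\<lambda>x. F (k + j) x - F (k + Suc j) x) \<le> (1/2) ^ (k + j)"
      using d[of "k + j"] by (subst norm2_diff_commute) simp
    finally show ?case using Suc by simp
  qed
  have bound: "(\<integral>\<^sup>+x. ennreal ((cmod (F k x - G x))\<^sup>2) \<partial>M) \<le> ennreal ((2 * (1/2) ^ k)\<^sup>2)" for k
  proof -
    have "(\<integral>\<^sup>+x. ennreal ((cmod (F k x - G x))\<^sup>2) \<partial>M)
        = (\<integral>\<^sup>+x. liminf (\<lambda>j. ennreal ((cmod (F k x - F (k + j) x))\<^sup>2)) \<partial>M)"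
    proof (rule nn_integral_cong_AE, use ae in eventually_elim)
      fix x assume "(\<lambda>k. F k x) \<longlonglongrightarrow> G x"
      then have "(\<lambda>j. F (k + j) x) \<longlonglongrightarrow> G x" using LIMSEQ_ignore_initial_segment[of "\<lambda>k. F k x" "G x" k] by (simp add: add.commute)
      then have "(\<lambda>j. ennreal ((cmod (F k x - F (k + j) x))\<^sup>2)) \<longlonglongrightarrow> ennreal ((cmod (F k x - G x))\<^sup>2)"
        by (intro tendsto_ennrealI tendsto_power tendsto_norm tendsto_diff tendsto_const)
      from lim_imp_Liminf[OF _ this]
      show "ennreal ((cmod (F k x - G x))\<^sup>2) = liminf (\<lambda>j. ennreal ((cmod (F k x - F (k + j) x))\<^sup>2))"
        by simp
    qed
    also have "\<dots> \<le> liminf (\<lambda>j. \<integral>\<^sup>+x. ennreal ((cmod (F k x - F (k + j) x))\<^sup>2) \<partial>M)"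
      by (rule nn_integral_liminf) measurable
    also have "\<dots> \<le> liminf (\<lambda>j::nat. ennreal ((2 * (1/2) ^ k)\<^sup>2))"
    proof (intro Liminf_mono always_eventually allI)
      fix j
      have "(\<integral>\<^sup>+x. ennreal ((cmod (F k x - F (k + j) x))\<^sup>2) \<partial>M) = ennreal ((norm2 M (\<lambda>x. F k x - F (k + j) x))\<^sup>2)"
        unfolding norm2_squared
        by (rule nn_integral_eq_integral) (use square_integrableD[OF square_integrable_diff[OF F F]] in auto)
      also have "\<dots> \<le> ennreal ((2 * (1/2) ^ k)\<^sup>2)"
        using dist[of k j] zero_le_power[of "1/2 :: real" "k + j"]
        by (intro ennreal_leI power_mono) (linarith, simp)
      finally show "(\<integral>\<^sup>+x. ennreal ((cmod (F k x - F (k + j) x))\<^sup>2) \<partial>M) \<le> ennreal ((2 * (1/2) ^ k)\<^sup>2)" .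
    qed
    finally show ?thesis by (simp add: Liminf_const)
  qed
  have i: "integrable M (\<lambda>x. (cmod (F k x - G x))\<^sup>2)" for k
    by (rule integrableI_bounded) (use bound[of k] le_less_trans[OF bound] in auto)
  have FG: "square_integrable M (\<lambda>x. F k x - G x)" for k
    using i[of k] by (auto simp: square_integrable_def)
  have "square_integrable M G" using square_integrable_diff[OF F FG, of 0 0] by simp
  moreover have "norm2 M (\<lambda>x. F k x - G x) \<le> 2 * (1/2) ^ k" for k
  proof -
    have "(norm2 M (\<lambda>x. F k x - G x))\<^sup>2 \<le> (2 * (1/2) ^ k)\<^sup>2"
      using bound[of k] nn_integral_eq_integral[OF i[of k]] by (simp add: norm2_squared)
    then show ?thesis by (rule power2_le_imp_le) simp
  qed
  then have le: "norm (norm2 M (\<lambda>x. F k x - G x)) \<le> 2 * (1/2) ^ k" for k by simp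
  have "(\<lambda>k. 2 * (1/2 :: real) ^ k) \<longlonglongrightarrow> 0"
    using tendsto_mult_right_zero[OF LIMSEQ_power_zero[of "1/2 :: real"], of 2] by simp
  then have "(\<lambda>k. norm2 M (\<lambda>x. F k x - G x)) \<longlonglongrightarrow> 0"
    by (rule Lim_null_comparison[rotated]) (rule always_eventually, rule allI, rule le)
  ultimately show ?thesis by (rule that)
qed

text \<open>
  A simple function takes finitely many values, so its modulus is bounded below where it does not
  vanish, and there $|s| \le C |s|^2$.
\<close>

lemma simple_square_integrable_imp_integrable:
  fixes s :: "'a \<Rightarrow> complex"
  assumes s: "simple_function M s" and s2: "square_integrable M s"
  shows "integrable M s"
proof -
  define C where "C = (\<Sum>c\<in>s ` space M. 1 / cmod c)"
  have le: "cmod (s x) \<le> C * (cmod (s x))\<^sup>2" if "x \<in> space M" for x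
  proof -
    have "1 / cmod (s x) \<le> C" unfolding C_def
      using that simple_functionD(1)[OF s] by (intro member_le_sum[of "s x" _ "\<lambda>c. 1 / cmod c"]) auto
    then have "1 / cmod (s x) * (cmod (s x))\<^sup>2 \<le> C * (cmod (s x))\<^sup>2" by (intro mult_right_mono) auto
    then show ?thesis by (cases "s x = 0") (auto simp: power2_eq_square)
  qed
  have C0: "0 \<le> C" unfolding C_def by (intro sum_nonneg) auto
  show ?thesis
    by (rule Bochner_Integration.integrable_bound[where f = "\<lambda>x. C * (cmod (s x))\<^sup>2"])
       (use square_integrableD[OF s2] square_integrable_measurable[OF s2] le C0 in auto)
qed

lemma square_integrable_simple_approx:
  assumes f: "square_integrable M f"
  obtains s where "\<And>k::nat. simple_function M (s k)" "\<And>k. integrable M (s k)"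
    "\<And>k. square_integrable M (s k)"
    "\<And>x. x \<in> space M \<Longrightarrow> (\<lambda>k. s k x) \<longlonglongrightarrow> f x"
    "\<And>k x. x \<in> space M \<Longrightarrow> cmod (s k x) \<le> 2 * cmod (f x)"
    "(\<lambda>k. norm2 M (\<lambda>x. s k x - f x)) \<longlonglongrightarrow> 0"
proof -
  obtain s where s: "\<And>k::nat. simple_function M (s k)"
    and lim: "\<And>x. x \<in> space M \<Longrightarrow> (\<lambda>k. s k x) \<longlonglongrightarrow> f x"
    and le: "\<And>k x. x \<in> space M \<Longrightarrow> cmod (s k x) \<le> 2 * cmod (f x)"
    using simple_function_approx[OF square_integrable_measurable[OF f]] by blast
  have m: "s k \<in> borel_measurable M" for k by (rule borel_measurable_simple_function[OF s])
  have s2: "square_integrable M (s k)" for k by (rule square_integrable_mono(1)[OF m f le]) auto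
  show ?thesis
    by (rule that[OF s simple_square_integrable_imp_integrable[OF s s2] s2 lim le
          norm2_dominated_tendsto[OF m f le lim]])
qed

lemma powr_integral_tendsto:
  fixes f :: "'a \<Rightarrow> complex"
  assumes s: "\<And>k::nat. s k \<in> borel_measurable M" and f: "f \<in> borel_measurable M"
    and i: "integrable M (\<lambda>x. cmod (f x) powr p)" and p: "0 < p"
    and lim: "\<And>x. x \<in> space M \<Longrightarrow> (\<lambda>k. s k x) \<longlonglongrightarrow> f x"
    and le: "\<And>k x. x \<in> space M \<Longrightarrow> cmod (s k x) \<le> 2 * cmod (f x)"
  shows "(\<lambda>k. LINT x|M. cmod (s k x) powr p) \<longlonglongrightarrow> (LINT x|M. cmod (f x) powr p)"
proof (rule integral_dominated_convergence[where w = "\<lambda>x. 2 powr p * cmod (f x) powr p"])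
  note [measurable] = s f
  show "AE x in M. (\<lambda>k. cmod (s k x) powr p) \<longlonglongrightarrow> cmod (f x) powr p"
  proof (rule AE_I2)
    fix x assume "x \<in> space M"
    then have "(\<lambda>k. cmod (s k x)) \<longlonglongrightarrow> cmod (f x)" by (intro tendsto_norm lim)
    then show "(\<lambda>k. cmod (s k x) powr p) \<longlonglongrightarrow> cmod (f x) powr p"
      using p by (intro tendsto_powr') auto
  qed
  show "AE x in M. norm (cmod (s k x) powr p) \<le> 2 powr p * cmod (f x) powr p" for k
  proof (rule AE_I2)
    fix x assume "x \<in> space M"
    then have "cmod (s k x) powr p \<le> (2 * cmod (f x)) powr p" using p le by (intro powr_mono2) auto
    then show "norm (cmod (s k x) powr p) \<le> 2 powr p * cmod (f x) powr p" by (simp add: powr_mult)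
  qed
qed (use i s f in auto)

lemma norm2_eq_0_if_powr:
  fixes u :: "'a \<Rightarrow> complex"
  assumes u: "integrable M (\<lambda>x. cmod (u x) powr p)" and 0: "(LINT x|M. cmod (u x) powr p) = 0"
  shows "norm2 M u = 0"
proof -
  have "AE x in M. cmod (u x) powr p = 0"
    using integral_nonneg_eq_0_iff_AE[OF u] 0 by simp
  then have "AE x in M. (cmod (u x))\<^sup>2 = 0" by eventually_elim simp
  then show ?thesis by (simp add: norm2_def integral_eq_zero_AE)
qed

section \<open>The Gaussian and its Fourier transform\<close>

lemma cis_measurable [measurable]: "cis \<in> borel_measurable borel"
  by (intro borel_measurable_continuous_onI continuous_intros)

lemma norm_squared_Basis: "(norm (z::'a::euclidean_space))\<^sup>2 = (\<Sum>b\<in>Basis. (z \<bullet> b)\<^sup>2)"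
  unfolding power2_norm_eq_inner euclidean_inner[of z z] by (simp add: power2_eq_square)

text \<open>
  Lebesgue measure on a Euclidean space is the image of the product of the Lebesgue measures on the
  coordinate axes, so integrals of products of one-variable functions factor. The one-dimensional
  Gaussian transform carries over to all dimensions in this way.
\<close>

lemma integral_lborel_prod_Basis:
  fixes f :: "'a::euclidean_space \<Rightarrow> real \<Rightarrow> complex"
  assumes f: "\<And>b. b \<in> Basis \<Longrightarrow> integrable lborel (f b)"
  shows "integrable lborel (\<lambda>z::'a. \<Prod>b\<in>Basis. f b (z \<bullet> b))"
    and "(LINT z|lborel. (\<Prod>b\<in>Basis. f b ((z::'a) \<bullet> b))) = (\<Prod>b\<in>Basis. (LINT x|lborel. f b x))"
proof -
  interpret product_sigma_finite "\<lambda>_::'a. lborel :: real measure" ..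
  define T where "T = (\<lambda>y::'a \<Rightarrow> real. \<Sum>b\<in>Basis. y b *\<^sub>R b)"
  have T [measurable]: "T \<in> (\<Pi>\<^sub>M b\<in>Basis. lborel) \<rightarrow>\<^sub>M borel"
    unfolding T_def by measurable
  have [measurable]: "f b \<in> borel_measurable borel" if "b \<in> Basis" for b
    using borel_measurable_integrable[OF f[OF that]] by simp
  have m: "(\<lambda>z::'a. \<Prod>b\<in>Basis. f b (z \<bullet> b)) \<in> borel_measurable borel"
    by measurable
  have eq: "(\<Prod>b\<in>Basis. f b (T y \<bullet> b)) = (\<Prod>b\<in>Basis. f b (y b))" for y
    unfolding T_def by (intro prod.cong refl arg_cong2[where f = f]) (simp add: inner_sum_left_Basis)
  have L: "lborel = distr (\<Pi>\<^sub>M b\<in>Basis. lborel) borel T"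
    unfolding T_def by (rule lborel_eq)
  show "integrable lborel (\<lambda>z::'a. \<Prod>b\<in>Basis. f b (z \<bullet> b))"
    unfolding L integrable_distr_eq[OF T m] eq
    by (rule product_integrable_prod) (use f in auto)
  have "(LINT z|lborel. (\<Prod>b\<in>Basis. f b ((z::'a) \<bullet> b)))
      = (LINT y|(\<Pi>\<^sub>M b\<in>Basis. lborel). (\<Prod>b\<in>Basis. f b (y b)))"
    unfolding L integral_distr[OF T m] eq ..
  also have "\<dots> = (\<Prod>b\<in>Basis. (LINT x|lborel. f b x))"
    by (rule product_integral_prod) (use f in auto)
  finally show "(LINT z|lborel. (\<Prod>b\<in>Basis. f b ((z::'a) \<bullet> b))) = (\<Prod>b\<in>Basis. (LINT x|lborel. f b x))" .
qed

text \<open>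
  The standard normal density in all coordinates. Its total mass is 1, so integrals against it are
  averages.
\<close>

definition gauss :: "'a::euclidean_space \<Rightarrow> real" where
  "gauss z = (\<Prod>b\<in>Basis. std_normal_density (z \<bullet> b))"

lemma gauss_eq: "gauss (z::'a::euclidean_space) = exp (- (norm z)\<^sup>2 / 2) / sqrt (2 * pi) ^ DIM('a)"
proof -
  have "gauss z = (\<Prod>b\<in>Basis. exp (- (z \<bullet> b)\<^sup>2 / 2)) / (\<Prod>b\<in>(Basis::'a set). sqrt (2 * pi))"
    by (simp add: gauss_def std_normal_density_def prod_dividef)
  also have "(\<Prod>b\<in>Basis. exp (- (z \<bullet> b)\<^sup>2 / 2)) = exp (- (norm z)\<^sup>2 / 2)"
    by (simp add: exp_sum[symmetric] sum_negf sum_divide_distrib[symmetric] norm_squared_Basis)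
  finally show ?thesis by simp
qed

lemma gauss_pos: "0 < gauss z"
  by (simp add: gauss_eq)

lemma gauss_measurable [measurable]: "gauss \<in> borel_measurable borel"
  unfolding gauss_def by measurable

lemma gauss_cis_eq:
  "complex_of_real (gauss z) * cis (z \<bullet> t)
    = (\<Prod>b\<in>Basis. complex_of_real (std_normal_density (z \<bullet> b)) * cis ((t \<bullet> b) * (z \<bullet> b)))"
proof -
  have "cis (z \<bullet> t) = (\<Prod>b\<in>Basis. cis ((t \<bullet> b) * (z \<bullet> b)))"
    unfolding euclidean_inner[of z t]
    by (simp add: cis_conv_exp exp_sum[symmetric] sum_distrib_left mult.commute)
  then show ?thesis by (simp add: gauss_def prod.distrib)
qed

lemma std_normal_integrable_cis:
  "integrable lborel (\<lambda>x. complex_of_real (std_normal_density x) * cis (t * x))"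
proof (rule Bochner_Integration.integrable_bound[where f = std_normal_density])
  show "integrable lborel std_normal_density" by simp
qed (auto simp: norm_mult)

lemma std_normal_cis_integral:
  "(LINT x|lborel. complex_of_real (std_normal_density x) * cis (t * x))
    = complex_of_real (exp (- t\<^sup>2 / 2))"
proof -
  have "char std_normal_distribution t
      = (LINT x|lborel. std_normal_density x *\<^sub>R iexp (t * x))"
    unfolding char_def by (subst integral_density) auto
  then show ?thesis
    by (simp add: char_std_normal_distribution cis_conv_exp scaleR_conv_of_real)
qed

lemma integrable_gauss: "integrable lborel (gauss :: 'a::euclidean_space \<Rightarrow> real)"
proof -
  have "integrable lborel (\<lambda>z::'a. complex_of_real (gauss z) * cis (z \<bullet> 0))"
    unfolding gauss_cis_eq by (rule integral_lborel_prod_Basis(1)) (rule std_normal_integrable_cis)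
  then show ?thesis using integrable_Re by fastforce
qed

lemma fourier_gauss:
  "(LINT z|lborel. complex_of_real (gauss z) * cis (z \<bullet> (t::'a::euclidean_space)))
    = complex_of_real (exp (- (norm t)\<^sup>2 / 2))"
proof -
  have "(LINT z|lborel. complex_of_real (gauss z) * cis (z \<bullet> t))
      = (\<Prod>b\<in>Basis. complex_of_real (exp (- (t \<bullet> b)\<^sup>2 / 2)))"
    unfolding gauss_cis_eq
    by (subst integral_lborel_prod_Basis(2))
       (auto simp: std_normal_integrable_cis std_normal_cis_integral)
  also have "\<dots> = complex_of_real (exp (\<Sum>b\<in>Basis. - (t \<bullet> b)\<^sup>2 / 2))"
    by (simp add: exp_sum)
  also have "(\<Sum>b\<in>Basis. - (t \<bullet> b)\<^sup>2 / 2) = - (norm t)\<^sup>2 / 2"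
    by (simp add: sum_negf sum_divide_distrib[symmetric] norm_squared_Basis)
  finally show ?thesis .
qed

lemma integral_gauss: "(LINT z|lborel. gauss (z::'a::euclidean_space)) = 1"
proof -
  have "complex_of_real (LINT z|lborel. gauss (z::'a)) = 1"
    using fourier_gauss[of "0::'a"] by simp
  then show ?thesis by (simp only: of_real_eq_1_iff)
qed

section \<open>Autocorrelation and the Bessel inequality\<close>

lemma lborel_translate:
  fixes f :: "'a::euclidean_space \<Rightarrow> 'b::{banach, second_countable_topology}"
  assumes [measurable]: "f \<in> borel_measurable borel"
  shows "integrable lborel (\<lambda>x. f (x + t)) \<longleftrightarrow> integrable lborel f"
    and "(LINT x|lborel. f (x + t)) = (LINT x|lborel. f x)"
proof -
  have L: "distr lborel borel ((+) t) = (lborel :: 'a measure)" by (rule lborel_distr_plus)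
  have m: "(+) t \<in> lborel \<rightarrow>\<^sub>M borel" by simp
  show "integrable lborel (\<lambda>x. f (x + t)) \<longleftrightarrow> integrable lborel f"
    using integrable_distr_eq[OF m assms] by (simp add: L add.commute)
  show "(LINT x|lborel. f (x + t)) = (LINT x|lborel. f x)"
    using integral_distr[OF m assms] by (simp add: L add.commute)
qed

lemma integral_lborel_scale:
  fixes f :: "'a::euclidean_space \<Rightarrow> complex"
  assumes [measurable]: "f \<in> borel_measurable borel" and c: "0 < c"
  shows "(LINT x|lborel. f x) = complex_of_real (c ^ DIM('a)) * (LINT x|lborel. f (c *\<^sub>R x))"
proof -
  have "(LINT x|lborel. f x)
      = (LINT x|density (distr lborel borel (\<lambda>x. 0 + c *\<^sub>R x)) (\<lambda>_. \<bar>c\<bar> ^ DIM('a)). f x)"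
    using lborel_affine[of c "0::'a"] c by simp
  also have "\<dots> = (LINT x|lborel. c ^ DIM('a) *\<^sub>R f (c *\<^sub>R x))"
    using c by (simp add: integral_density integral_distr)
  finally show ?thesis by (simp add: scaleR_conv_of_real)
qed

lemma integrable_gauss_scale:
  assumes c: "0 < c"
  shows "integrable lborel (\<lambda>x::'a::euclidean_space. gauss (c *\<^sub>R x))"
proof -
  have "integrable (density (distr lborel borel (\<lambda>x. 0 + c *\<^sub>R x)) (\<lambda>_. \<bar>c\<bar> ^ DIM('a))) (gauss :: 'a \<Rightarrow> real)"
    using lborel_affine[of c "0::'a"] c by (simp add: integrable_gauss)
  then have "integrable lborel (\<lambda>x::'a. c ^ DIM('a) *\<^sub>R gauss (c *\<^sub>R x))"
    using c by (simp add: integrable_density integrable_distr_eq)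
  then show ?thesis using c by simp
qed

text \<open>
  The Fourier integral over Borel--Lebesgue measure. Fubini's theorem is available for
  \<^const>\<open>lborel\<close>, whereas \<^const>\<open>lebesgue\<close> is not a product measure; the two
  transforms agree after passage to a Borel representative, see \<open>plancherel_lebesgue\<close>.
\<close>

definition ft :: "('a::euclidean_space \<Rightarrow> complex) \<Rightarrow> 'a \<Rightarrow> complex" where
  "ft f \<xi> = (LINT x|lborel. f x * cis (- (2 * pi * (x \<bullet> \<xi>))))"

lemma ft_measurable [measurable]:
  assumes [measurable]: "f \<in> borel_measurable borel"
  shows "ft f \<in> borel_measurable borel"
  unfolding ft_def by measurable

lemma integrable_mult_cis:
  fixes f :: "'a::euclidean_space \<Rightarrow> complex"
  assumes "integrable lborel f"
  shows "integrable lborel (\<lambda>x. f x * cis (c * (x \<bullet> \<xi>)))"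
  using assms by (rule Bochner_Integration.integrable_bound)
    (use borel_measurable_integrable[OF assms] in \<open>auto simp: norm_mult\<close>)

lemma integrable_ft_kernel:
  assumes "integrable lborel f"
  shows "integrable lborel (\<lambda>x. f x * cis (- (2 * pi * (x \<bullet> \<xi>))))"
  using integrable_mult_cis[OF assms, of "- 2 * pi"] by simp

lemma norm_ft_le: "cmod (ft f \<xi>) \<le> (LINT x|lborel. cmod (f x))"
  unfolding ft_def using integral_norm_bound[of lborel "\<lambda>x. f x * cis (- (2 * pi * (x \<bullet> \<xi>)))"]
  by (simp add: norm_mult)

text \<open>
  The convolution of $f$ with the conjugate of its reflection, with value $\|f\|_2^2$ at $0$.
\<close>

definition autocorr :: "('a::euclidean_space \<Rightarrow> complex) \<Rightarrow> 'a \<Rightarrow> complex" where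
  "autocorr f t = (LINT y|lborel. f (y + t) * cnj (f y))"

lemma autocorr_integrable_pair:
  assumes f: "integrable lborel f"
  shows "integrable (lborel \<Otimes>\<^sub>M lborel) (\<lambda>(y, t). f (y + t) * cnj (f y))"
proof (rule lborel_pair.Fubini_integrable)
  have [measurable]: "f \<in> borel_measurable borel" using f by auto
  show "(\<lambda>(y, t). f (y + t) * cnj (f y)) \<in> borel_measurable (lborel \<Otimes>\<^sub>M lborel)"
    by measurable
  have tr: "integrable lborel (\<lambda>t. f (y + t))" "(LINT t|lborel. cmod (f (y + t))) = (LINT t|lborel. cmod (f t))" for y
    using lborel_translate[of f y] lborel_translate[of "\<lambda>x. cmod (f x)" y] f by (auto simp: add.commute)
  show "AE y in lborel. integrable lborel (\<lambda>t. case (y, t) of (y, t) \<Rightarrow> f (y + t) * cnj (f y))"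
    using tr(1) by simp
  have "(\<lambda>y. LINT t|lborel. cmod (case (y, t) of (y, t) \<Rightarrow> f (y + t) * cnj (f y)))
      = (\<lambda>y. (LINT t|lborel. cmod (f t)) * cmod (f y))"
    using tr(2) by (simp add: norm_mult)
  then show "integrable lborel (\<lambda>y. LINT t|lborel. cmod (case (y, t) of (y, t) \<Rightarrow> f (y + t) * cnj (f y)))"
    using integrable_norm[OF f] by simp
qed

lemma integrable_autocorr:
  assumes "integrable lborel f"
  shows "integrable lborel (autocorr f)"
  using lborel_pair.integrable_snd[OF autocorr_integrable_pair[OF assms]]
  by (simp add: autocorr_def[abs_def])

text \<open>
  The convolution theorem in the one case that is needed: the transform of an autocorrelation is
  nonnegative.
\<close>

lemma ft_autocorr:
  assumes f: "integrable lborel f"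
  shows "ft (autocorr f) \<xi> = complex_of_real ((cmod (ft f \<xi>))\<^sup>2)"
proof -
  have [measurable]: "f \<in> borel_measurable borel" using f by auto
  define e where "e = (\<lambda>x. cis (- (2 * pi * (x \<bullet> \<xi>))))"
  have e_add: "e (x + y) = e x * e y" for x y
    by (simp add: e_def cis_mult inner_add_left algebra_simps)
  \<comment> \<open>The character is multiplicative and unimodular, so the kernel at t splits into a factor in y + t and a factor in y.\<close>
  have e_cnj: "e x * cnj (e x) = 1" for x
    by (simp add: e_def complex_norm_square[symmetric])
  have ft_e: "ft g \<xi> = (LINT x|lborel. g x * e x)" for g
    by (simp add: ft_def e_def)
  have [measurable]: "e \<in> borel_measurable borel" unfolding e_def by measurable
  have i: "integrable (lborel \<Otimes>\<^sub>M lborel) (\<lambda>(y, t). f (y + t) * cnj (f y) * e t)"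
    by (rule Bochner_Integration.integrable_bound[OF autocorr_integrable_pair[OF f]])
       (auto simp: norm_mult e_def)
  have "ft (autocorr f) \<xi> = (LINT t|lborel. (LINT y|lborel. f (y + t) * cnj (f y) * e t))"
    unfolding ft_e autocorr_def by simp
  also have "\<dots> = (LINT y|lborel. (LINT t|lborel. f (y + t) * cnj (f y) * e t))"
    by (rule lborel_pair.Fubini_integral[OF i])
  also have "\<dots> = (LINT y|lborel. ft f \<xi> * cnj (f y * e y))"
  proof (intro Bochner_Integration.integral_cong refl)
    fix y
    have "f (y + t) * cnj (f y) * e t = cnj (f y * e y) * (f (y + t) * e (y + t))" for t
      using e_cnj[of y] by (simp add: e_add mult.commute[of "cnj (e y)"])
    then have "(LINT t|lborel. f (y + t) * cnj (f y) * e t)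
        = cnj (f y * e y) * (LINT t|lborel. f (y + t) * e (y + t))"
      by (simp only: integral_mult_right_zero)
    also have "\<dots> = cnj (f y * e y) * (LINT t|lborel. f (t + y) * e (t + y))"
      by (simp only: add.commute)
    also have "\<dots> = cnj (f y * e y) * ft f \<xi>"
      by (subst lborel_translate(2)[of "\<lambda>x. f x * e x"]) (auto simp: ft_e)
    finally show "(LINT t|lborel. f (y + t) * cnj (f y) * e t) = ft f \<xi> * cnj (f y * e y)"
      by (simp add: mult.commute)
  qed
  also have "\<dots> = ft f \<xi> * cnj (ft f \<xi>)"
    using Bochner_Integration.integral_cnj[of lborel "\<lambda>x. f x * e x"]
    by (simp only: ft_e integral_mult_right_zero)
  finally show ?thesis by (simp add: complex_norm_square[symmetric])
qed

lemma ft_multiplication: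
  fixes h w :: "'a::euclidean_space \<Rightarrow> complex"
  assumes h: "integrable lborel h" and w: "integrable lborel w"
  shows "(LINT \<xi>|lborel. ft h \<xi> * w \<xi>) = (LINT t|lborel. h t * ft w t)"
proof -
  have [measurable]: "h \<in> borel_measurable borel" "w \<in> borel_measurable borel" using h w by auto
  let ?K = "\<lambda>t \<xi>. h t * cis (- (2 * pi * (t \<bullet> \<xi>))) * w \<xi>"
  have i: "integrable (lborel \<Otimes>\<^sub>M lborel) (case_prod ?K)"
  proof (rule lborel_pair.Fubini_integrable)
    show "case_prod ?K \<in> borel_measurable (lborel \<Otimes>\<^sub>M lborel)" by measurable
    show "integrable lborel (\<lambda>t. LINT \<xi>|lborel. cmod (case (t, \<xi>) of (t, \<xi>) \<Rightarrow> ?K t \<xi>))"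
      using integrable_norm[OF h] by (simp add: norm_mult)
    show "AE t in lborel. integrable lborel (\<lambda>\<xi>. case (t, \<xi>) of (t, \<xi>) \<Rightarrow> ?K t \<xi>)"
    proof (rule AE_I2)
      fix t
      have "(\<lambda>\<xi>. ?K t \<xi>) = (\<lambda>\<xi>. h t * (w \<xi> * cis (- (2 * pi * (\<xi> \<bullet> t)))))"
        by (intro ext) (simp add: inner_commute)
      then show "integrable lborel (\<lambda>\<xi>. case (t, \<xi>) of (t, \<xi>) \<Rightarrow> ?K t \<xi>)"
        using integrable_mult_right[OF integrable_ft_kernel[OF w], of "h t" t] by simp
    qed
  qed
  have "(LINT \<xi>|lborel. ft h \<xi> * w \<xi>) = (LINT \<xi>|lborel. (LINT t|lborel. ?K t \<xi>))"
    unfolding ft_def by simp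
  also have "\<dots> = (LINT t|lborel. (LINT \<xi>|lborel. ?K t \<xi>))"
    by (rule lborel_pair.Fubini_integral[OF i])
  also have "\<dots> = (LINT t|lborel. h t * ft w t)"
    unfolding ft_def by (simp add: mult.assoc inner_commute mult.commute[of "cis _"])
  finally show ?thesis .
qed

text \<open>
  The multiplication formula moves the transform from the autocorrelation to the Gaussian weight.
  That weight has a narrow transform when it is wide: the width parameter $\sigma$ tends to $0$
  exactly when the weight tends to $1$, and the right-hand side is then an average of the
  autocorrelation over a shrinking neighbourhood of $0$.
\<close>

lemma integral_norm_ft_gauss:
  fixes f :: "'a::euclidean_space \<Rightarrow> complex"
  assumes f: "integrable lborel f" and \<sigma>: "0 < \<sigma>"
  shows "complex_of_real (LINT \<xi>|lborel. (cmod (ft f \<xi>))\<^sup>2 * exp (- (norm ((2 * pi * \<sigma>) *\<^sub>R \<xi>))\<^sup>2 / 2))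
    = (LINT z|lborel. autocorr f (\<sigma> *\<^sub>R z) * complex_of_real (gauss z))"
proof -
  have [measurable]: "f \<in> borel_measurable borel" using f by auto
  have h: "integrable lborel (autocorr f)" by (rule integrable_autocorr[OF f])
  have [measurable]: "autocorr f \<in> borel_measurable borel" using h by auto
  define c where "c = 2 * pi * \<sigma>"
  have c: "c > 0" using \<sigma> by (simp add: c_def)
  \<comment> \<open>C is 1 / gauss 0. The two factors C come from normalizing the weight before and after the transform; together they cancel the powers of 2 * pi in c.\<close>
  define C where "C = sqrt (2 * pi) ^ DIM('a)"
  have C0: "C > 0" by (simp add: C_def)
  have CC: "C * C = (2 * pi) ^ DIM('a)" unfolding C_def power_mult_distrib[symmetric] by simp
  have exp_gauss: "exp (- (norm z)\<^sup>2 / 2) = C * gauss z" for z :: 'a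
    by (simp add: gauss_eq C_def)
  let ?w = "\<lambda>\<xi>::'a. complex_of_real (gauss (c *\<^sub>R \<xi>))"
  have w: "integrable lborel ?w" by (intro integrable_of_real integrable_gauss_scale c)
  have ftw: "complex_of_real (c ^ DIM('a)) * ft ?w t = complex_of_real (C * gauss ((1/\<sigma>) *\<^sub>R t))" for t
  proof -
    let ?s = "- (2 * pi / c) *\<^sub>R t"
    have "ft ?w t = (LINT \<xi>|lborel. complex_of_real (gauss (c *\<^sub>R \<xi>)) * cis ((c *\<^sub>R \<xi>) \<bullet> ?s))"
      unfolding ft_def using c by (simp add: mult.assoc)
    then have "complex_of_real (c ^ DIM('a)) * ft ?w t
        = (LINT z|lborel. complex_of_real (gauss z) * cis (z \<bullet> ?s))"
      by (subst integral_lborel_scale[OF _ c]) auto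
    also have "\<dots> = complex_of_real (exp (- (norm ?s)\<^sup>2 / 2))" by (rule fourier_gauss)
    also have "norm ?s = norm ((1/\<sigma>) *\<^sub>R t)" using \<sigma> by (simp add: c_def)
    finally show ?thesis by (simp only: exp_gauss)
  qed
  have "complex_of_real (LINT \<xi>|lborel. (cmod (ft f \<xi>))\<^sup>2 * exp (- (norm (c *\<^sub>R \<xi>))\<^sup>2 / 2))
      = (LINT \<xi>|lborel. complex_of_real C * (ft (autocorr f) \<xi> * ?w \<xi>))"
    unfolding exp_gauss integral_complex_of_real[symmetric]
    by (intro Bochner_Integration.integral_cong refl) (simp add: ft_autocorr[OF f])
  also have "\<dots> = complex_of_real C * (LINT t|lborel. autocorr f t * ft ?w t)"
    by (simp add: ft_multiplication[OF h w])
  also have "\<dots> = complex_of_real (C / c ^ DIM('a)) *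
      (LINT t|lborel. autocorr f t * complex_of_real (C * gauss ((1/\<sigma>) *\<^sub>R t)))"
  proof -
    have "(LINT t|lborel. autocorr f t * (K * ft ?w t)) = K * (LINT t|lborel. autocorr f t * ft ?w t)" for K
      by (simp add: mult.left_commute[of _ K])
    then show ?thesis unfolding ftw[symmetric] using c by simp
  qed
  also have "\<dots> = complex_of_real (C / c ^ DIM('a)) * (complex_of_real (\<sigma> ^ DIM('a)) *
      (LINT z|lborel. autocorr f (\<sigma> *\<^sub>R z) * complex_of_real (C * gauss z)))"
    by (subst integral_lborel_scale[OF _ \<sigma>]) (use \<sigma> in auto)
  also have "\<dots> = complex_of_real (C * C * \<sigma> ^ DIM('a) / c ^ DIM('a)) *
      (LINT z|lborel. autocorr f (\<sigma> *\<^sub>R z) * complex_of_real (gauss z))"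
    by (simp add: mult.left_commute)
  also have "C * C * \<sigma> ^ DIM('a) / c ^ DIM('a) = 1"
    using \<sigma> by (simp add: CC c_def power_mult_distrib)
  finally show ?thesis by (simp add: c_def)
qed

lemma norm2_translate:
  fixes f :: "'a::euclidean_space \<Rightarrow> complex"
  assumes f: "square_integrable lborel f"
  shows "square_integrable lborel (\<lambda>x. f (x + t))" "norm2 lborel (\<lambda>x. f (x + t)) = norm2 lborel f"
proof -
  have [measurable]: "f \<in> borel_measurable borel" using square_integrable_measurable[OF f] by simp
  show "square_integrable lborel (\<lambda>x. f (x + t))" "norm2 lborel (\<lambda>x. f (x + t)) = norm2 lborel f"
    using lborel_translate[of "\<lambda>x. (cmod (f x))\<^sup>2" t] f
    by (auto simp: square_integrable_def norm2_def)
qed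

lemma norm_autocorr_le:
  assumes f: "square_integrable lborel f"
  shows "cmod (autocorr f t) \<le> (norm2 lborel f)\<^sup>2"
  unfolding autocorr_def
  using Cauchy_Schwarz_integral(3)[OF norm2_translate(1)[OF f] square_integrable_cnj(1)[OF f]]
  by (simp add: norm2_translate(2)[OF f] square_integrable_cnj(2)[OF f] power2_eq_square)

lemma autocorr_0: "autocorr f 0 = complex_of_real ((norm2 lborel f)\<^sup>2)"
  unfolding norm2_squared autocorr_def integral_complex_of_real[symmetric]
  by (simp add: complex_norm_square[symmetric])

lemma gauss_weight_le: "0 \<le> a \<Longrightarrow> norm (a * exp (- c\<^sup>2 / 2)) \<le> (a::real)"
  by (simp add: abs_mult mult_left_le)

lemma gauss_weight_tendsto:
  fixes \<xi> :: "'a::euclidean_space"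
  shows "(\<lambda>k. exp (- (norm ((2 * pi * (1 / real (Suc k))) *\<^sub>R \<xi>))\<^sup>2 / 2)) \<longlonglongrightarrow> 1"
proof -
  have "(\<lambda>k. exp (- (norm ((2 * pi * (1 / real (Suc k))) *\<^sub>R \<xi>))\<^sup>2 / 2))
      \<longlonglongrightarrow> exp (- (norm ((2 * pi * 0) *\<^sub>R \<xi>))\<^sup>2 / 2)"
    using LIMSEQ_Suc[OF lim_1_over_n] by (intro tendsto_intros) auto
  then show ?thesis by simp
qed

text \<open>
  The Bessel half of Plancherel's theorem. The Gaussian averages of the autocorrelation are bounded
  by $\|f\|_2^2$, and Fatou's lemma removes the weight.
\<close>

lemma ft_square_integrable:
  fixes f :: "'a::euclidean_space \<Rightarrow> complex"
  assumes f: "integrable lborel f" and f2: "square_integrable lborel f"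
  shows "square_integrable lborel (ft f)" "norm2 lborel (ft f) \<le> norm2 lborel f"
proof -
  have [measurable]: "f \<in> borel_measurable borel" using f by auto
  define w :: "nat \<Rightarrow> 'a \<Rightarrow> real"
    where "w k \<xi> = exp (- (norm ((2 * pi * (1 / real (Suc k))) *\<^sub>R \<xi>))\<^sup>2 / 2)" for k \<xi>
  have [measurable]: "w k \<in> borel_measurable borel" for k unfolding w_def by measurable
  have bound: "(\<integral>\<^sup>+\<xi>. ennreal ((cmod (ft f \<xi>))\<^sup>2 * w k \<xi>) \<partial>lborel) \<le> ennreal ((norm2 lborel f)\<^sup>2)" for k
  proof -
    let ?\<sigma> = "1 / real (Suc k)"
    let ?D = "LINT \<xi>|lborel. (cmod (ft f \<xi>))\<^sup>2 * w k \<xi>"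
    have D: "complex_of_real ?D = (LINT z|lborel. autocorr f (?\<sigma> *\<^sub>R z) * complex_of_real (gauss z))"
      unfolding w_def by (rule integral_norm_ft_gauss[OF f]) simp
    have "cmod (complex_of_real ?D)
        \<le> (LINT z|lborel. cmod (autocorr f (?\<sigma> *\<^sub>R z) * complex_of_real (gauss z)))"
      unfolding D by (rule integral_norm_bound)
    also have "\<dots> \<le> (LINT z|lborel. (norm2 lborel f)\<^sup>2 * gauss (z::'a))"
    proof (rule integral_mono')
      show "integrable lborel (\<lambda>z::'a. (norm2 lborel f)\<^sup>2 * gauss z)" by (simp add: integrable_gauss)
      show "cmod (autocorr f (?\<sigma> *\<^sub>R z) * complex_of_real (gauss z)) \<le> (norm2 lborel f)\<^sup>2 * gauss z" for z :: 'a
        using norm_autocorr_le[OF f2] gauss_pos[of z] by (simp add: norm_mult mult_right_mono)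
    qed (simp add: gauss_pos less_imp_le)
    finally have le: "?D \<le> (norm2 lborel f)\<^sup>2" by (simp add: integral_gauss)
    have "w k = (\<lambda>\<xi>. sqrt (2 * pi) ^ DIM('a) * gauss ((2 * pi * ?\<sigma>) *\<^sub>R \<xi>))"
      by (intro ext) (simp add: w_def gauss_eq)
    then have "integrable lborel (w k)"
      by (simp only:) (intro integrable_mult_right integrable_gauss_scale, simp)
    then have "integrable lborel (\<lambda>\<xi>. (LINT x|lborel. cmod (f x))\<^sup>2 * w k \<xi>)" by simp
    then have "integrable lborel (\<lambda>\<xi>. (cmod (ft f \<xi>))\<^sup>2 * w k \<xi>)"
      by (rule Bochner_Integration.integrable_bound)
         (auto simp: w_def abs_mult intro!: mult_right_mono power_mono norm_ft_le)
    then have "(\<integral>\<^sup>+\<xi>. ennreal ((cmod (ft f \<xi>))\<^sup>2 * w k \<xi>) \<partial>lborel) = ennreal ?D"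
      by (rule nn_integral_eq_integral) (auto simp: w_def)
    then show ?thesis using le by (simp add: ennreal_leI)
  qed
  have "(\<integral>\<^sup>+\<xi>. ennreal ((cmod (ft f \<xi>))\<^sup>2) \<partial>lborel)
      = (\<integral>\<^sup>+\<xi>. liminf (\<lambda>k. ennreal ((cmod (ft f \<xi>))\<^sup>2 * w k \<xi>)) \<partial>lborel)"
  proof (intro nn_integral_cong)
    fix \<xi>
    have "(\<lambda>k. ennreal ((cmod (ft f \<xi>))\<^sup>2 * w k \<xi>)) \<longlonglongrightarrow> ennreal ((cmod (ft f \<xi>))\<^sup>2 * 1)"
      unfolding w_def by (intro tendsto_ennrealI tendsto_mult tendsto_const gauss_weight_tendsto)
    then show "ennreal ((cmod (ft f \<xi>))\<^sup>2) = liminf (\<lambda>k. ennreal ((cmod (ft f \<xi>))\<^sup>2 * w k \<xi>))"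
      by (simp add: lim_imp_Liminf)
  qed
  also have "\<dots> \<le> liminf (\<lambda>k. \<integral>\<^sup>+\<xi>. ennreal ((cmod (ft f \<xi>))\<^sup>2 * w k \<xi>) \<partial>lborel)"
    by (rule nn_integral_liminf) auto
  also have "\<dots> \<le> ennreal ((norm2 lborel f)\<^sup>2)"
    using Liminf_mono[of "\<lambda>k. \<integral>\<^sup>+\<xi>. ennreal ((cmod (ft f \<xi>))\<^sup>2 * w k \<xi>) \<partial>lborel"
        "\<lambda>_. ennreal ((norm2 lborel f)\<^sup>2)" sequentially] bound
    by (simp add: Liminf_const)
  finally have nn: "(\<integral>\<^sup>+\<xi>. ennreal ((cmod (ft f \<xi>))\<^sup>2) \<partial>lborel) \<le> ennreal ((norm2 lborel f)\<^sup>2)" .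
  have i: "integrable lborel (\<lambda>\<xi>. (cmod (ft f \<xi>))\<^sup>2)"
    by (rule integrableI_bounded) (use nn le_less_trans[OF nn] in auto)
  then show "square_integrable lborel (ft f)" by (auto simp: square_integrable_def)
  have "(norm2 lborel (ft f))\<^sup>2 \<le> (norm2 lborel f)\<^sup>2"
    using nn nn_integral_eq_integral[OF i] by (simp add: norm2_squared[of _ "ft f"])
  then show "norm2 lborel (ft f) \<le> norm2 lborel f" by (rule power2_le_imp_le) simp
qed

text \<open>
  For bounded continuous $f$ the autocorrelation is continuous at $0$ by dominated convergence, so the
  Gaussian averages converge to $\|f\|_2^2$.
\<close>

lemma norm2_ft_continuous:
  fixes f :: "'a::euclidean_space \<Rightarrow> complex"
  assumes f: "integrable lborel f" and f2: "square_integrable lborel f"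
    and cont: "continuous_on UNIV f" and bd: "\<And>x. cmod (f x) \<le> B"
  shows "norm2 lborel (ft f) = norm2 lborel f"
proof -
  have [measurable]: "f \<in> borel_measurable borel" using f by auto
  have [measurable]: "autocorr f \<in> borel_measurable borel" using integrable_autocorr[OF f] by auto
  let ?\<sigma> = "\<lambda>k. 1 / real (Suc k)"
  have \<sigma>: "?\<sigma> \<longlonglongrightarrow> 0" by (rule LIMSEQ_Suc[OF lim_1_over_n])
  have B: "0 \<le> B" using bd[of 0] norm_ge_zero[of "f 0"] by linarith
  have ac: "(\<lambda>k. autocorr f (?\<sigma> k *\<^sub>R z)) \<longlonglongrightarrow> autocorr f 0" for z
    unfolding autocorr_def
  proof (rule integral_dominated_convergence[where w = "\<lambda>y. B * cmod (f y)"])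
    show "AE y in lborel. (\<lambda>k. f (y + ?\<sigma> k *\<^sub>R z) * cnj (f y)) \<longlonglongrightarrow> f (y + 0) * cnj (f y)"
    proof (rule AE_I2)
      fix y
      have "(\<lambda>k. y + ?\<sigma> k *\<^sub>R z) \<longlonglongrightarrow> y + 0 *\<^sub>R z" by (intro tendsto_intros \<sigma>)
      then have "(\<lambda>k. f (y + ?\<sigma> k *\<^sub>R z)) \<longlonglongrightarrow> f (y + 0)"
        by (intro continuous_on_tendsto_compose[OF cont]) auto
      then show "(\<lambda>k. f (y + ?\<sigma> k *\<^sub>R z) * cnj (f y)) \<longlonglongrightarrow> f (y + 0) * cnj (f y)"
        by (intro tendsto_intros)
    qed
    show "integrable lborel (\<lambda>y. B * cmod (f y))" using integrable_norm[OF f] by simp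
  qed (auto simp: norm_mult intro!: mult_right_mono bd)
  have lim1: "(\<lambda>k. LINT z|lborel. autocorr f (?\<sigma> k *\<^sub>R z) * complex_of_real (gauss z))
      \<longlonglongrightarrow> (LINT z|lborel. autocorr f 0 * complex_of_real (gauss (z::'a)))"
  proof (rule integral_dominated_convergence[where w = "\<lambda>z. (norm2 lborel f)\<^sup>2 * gauss z"])
    show "AE z in lborel. (\<lambda>k. autocorr f (?\<sigma> k *\<^sub>R z) * complex_of_real (gauss z))
        \<longlonglongrightarrow> autocorr f 0 * complex_of_real (gauss z)"
      by (intro AE_I2 tendsto_mult tendsto_const ac)
    show "AE z in lborel. cmod (autocorr f (?\<sigma> k *\<^sub>R z) * complex_of_real (gauss z))
        \<le> (norm2 lborel f)\<^sup>2 * gauss z" for k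
      by (intro AE_I2)
         (simp add: norm_mult abs_of_pos[OF gauss_pos] mult_right_mono[OF norm_autocorr_le[OF f2] less_imp_le[OF gauss_pos]])
  qed (auto simp: integrable_gauss)
  have lim2: "(\<lambda>k. LINT \<xi>|lborel. (cmod (ft f \<xi>))\<^sup>2 * exp (- (norm ((2 * pi * ?\<sigma> k) *\<^sub>R \<xi>))\<^sup>2 / 2))
      \<longlonglongrightarrow> (LINT \<xi>|lborel. (cmod (ft f \<xi>))\<^sup>2)"
  proof (rule integral_dominated_convergence[where w = "\<lambda>\<xi>. (cmod (ft f \<xi>))\<^sup>2"])
    show "AE \<xi> in lborel. (\<lambda>k. (cmod (ft f \<xi>))\<^sup>2 * exp (- (norm ((2 * pi * ?\<sigma> k) *\<^sub>R \<xi>))\<^sup>2 / 2))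
        \<longlonglongrightarrow> (cmod (ft f \<xi>))\<^sup>2"
      using tendsto_mult[OF tendsto_const gauss_weight_tendsto] by (intro AE_I2) fastforce
    show "integrable lborel (\<lambda>\<xi>. (cmod (ft f \<xi>))\<^sup>2)"
      by (rule square_integrableD[OF ft_square_integrable(1)[OF f f2]])
    show "AE \<xi> in lborel. norm ((cmod (ft f \<xi>))\<^sup>2 * exp (- (norm ((2 * pi * ?\<sigma> k) *\<^sub>R \<xi>))\<^sup>2 / 2))
        \<le> (cmod (ft f \<xi>))\<^sup>2" for k
      by (intro AE_I2 gauss_weight_le) simp
  qed auto
  have ig: "complex_of_real (LINT \<xi>|lborel. (cmod (ft f \<xi>))\<^sup>2 * exp (- (norm ((2 * pi * ?\<sigma> k) *\<^sub>R \<xi>))\<^sup>2 / 2))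
      = (LINT z|lborel. autocorr f (?\<sigma> k *\<^sub>R z) * complex_of_real (gauss z))" for k
    by (rule integral_norm_ft_gauss[OF f]) simp
  have "(\<lambda>k. LINT z|lborel. autocorr f (?\<sigma> k *\<^sub>R z) * complex_of_real (gauss z))
      \<longlonglongrightarrow> complex_of_real (LINT \<xi>|lborel. (cmod (ft f \<xi>))\<^sup>2)"
    unfolding ig[symmetric] by (rule tendsto_of_real[OF lim2])
  from LIMSEQ_unique[OF this lim1]
  have "complex_of_real ((norm2 lborel (ft f))\<^sup>2) = autocorr f 0 * complex_of_real (LINT z|lborel. gauss (z::'a))"
    by (simp only: norm2_squared integral_mult_right_zero integral_complex_of_real)
  then have "(norm2 lborel (ft f))\<^sup>2 = (norm2 lborel f)\<^sup>2"
    unfolding integral_gauss autocorr_0 by (simp del: of_real_power)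
  then show ?thesis by (simp add: power2_eq_iff_nonneg)
qed

section \<open>Plancherel's theorem\<close>

lemma ft_add:
  assumes "integrable lborel f" "integrable lborel g"
  shows "ft (\<lambda>x. f x + g x) \<xi> = ft f \<xi> + ft g \<xi>"
  unfolding ft_def distrib_right
  by (intro Bochner_Integration.integral_add integrable_ft_kernel assms)

lemma ft_cmult: "ft (\<lambda>x. c * f x) \<xi> = c * ft f \<xi>"
  unfolding ft_def by (simp only: mult.assoc integral_mult_right_zero)

lemma ft_diff:
  assumes "integrable lborel f" "integrable lborel g"
  shows "ft (\<lambda>x. f x - g x) \<xi> = ft f \<xi> - ft g \<xi>"
  using ft_add[OF assms(1), of "\<lambda>x. - 1 * g x"] ft_cmult[of "-1" g] assms(2) by simp

text \<open>
  The functions in $L^1 \cap L^2$ for which Plancherel's identity holds; the lemmas below enlarge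
  this class step by step.
\<close>

definition ft_isometric :: "('a::euclidean_space \<Rightarrow> complex) \<Rightarrow> bool" where
  "ft_isometric f \<longleftrightarrow> integrable lborel f \<and> square_integrable lborel f \<and>
     norm2 lborel (ft f) = norm2 lborel f"

text \<open>
  By the parallelogram law the squared norms of $f + g$ and $f - g$ have the same sum before and after
  the transform, because $f$ and $g$ keep their norms. Neither summand can increase, so neither can
  decrease.
\<close>

lemma ft_isometric_add:
  assumes f: "ft_isometric f" and g: "ft_isometric g"
  shows "ft_isometric (\<lambda>x. f x + g x)"
proof -
  have f': "integrable lborel f" "square_integrable lborel f" "norm2 lborel (ft f) = norm2 lborel f"
    and g': "integrable lborel g" "square_integrable lborel g" "norm2 lborel (ft g) = norm2 lborel g"
    using f g by (auto simp: ft_isometric_def)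
  let ?s = "\<lambda>x. f x + g x" and ?d = "\<lambda>x. f x - g x"
  have s: "integrable lborel ?s" "square_integrable lborel ?s"
    and d: "integrable lborel ?d" "square_integrable lborel ?d"
    using f' g' by (auto simp: square_integrable_add square_integrable_diff)
  have fts: "ft ?s = (\<lambda>\<xi>. ft f \<xi> + ft g \<xi>)" "ft ?d = (\<lambda>\<xi>. ft f \<xi> - ft g \<xi>)"
    by (auto simp: ft_add ft_diff f' g')
  have "(norm2 lborel (ft ?s))\<^sup>2 + (norm2 lborel (ft ?d))\<^sup>2 = (norm2 lborel ?s)\<^sup>2 + (norm2 lborel ?d)\<^sup>2"
    unfolding fts norm2_parallelogram[OF f'(2) g'(2)]
      norm2_parallelogram[OF ft_square_integrable(1)[OF f'(1,2)] ft_square_integrable(1)[OF g'(1,2)]]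
    by (simp add: f' g')
  moreover have "(norm2 lborel (ft ?s))\<^sup>2 \<le> (norm2 lborel ?s)\<^sup>2" "(norm2 lborel (ft ?d))\<^sup>2 \<le> (norm2 lborel ?d)\<^sup>2"
    by (intro power_mono ft_square_integrable(2) s d norm2_nonneg)+
  ultimately have "(norm2 lborel (ft ?s))\<^sup>2 = (norm2 lborel ?s)\<^sup>2" by linarith
  then show ?thesis using s by (simp add: ft_isometric_def power2_eq_iff_nonneg)
qed

lemma ft_isometric_cmult:
  assumes "ft_isometric f"
  shows "ft_isometric (\<lambda>x. c * f x)"
proof -
  have "ft (\<lambda>x. c * f x) = (\<lambda>\<xi>. c * ft f \<xi>)" by (intro ext ft_cmult)
  then show ?thesis using assms ft_square_integrable(1)[of f]
    by (simp add: ft_isometric_def square_integrable_cmult)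
qed

lemma ft_isometric_0: "ft_isometric (\<lambda>x. 0)"
proof -
  have "ft (\<lambda>x. 0) = (\<lambda>\<xi>::'a. 0)" by (intro ext) (simp add: ft_def)
  then show ?thesis by (simp add: ft_isometric_def square_integrable_def)
qed

lemma ft_isometric_sum:
  "finite I \<Longrightarrow> (\<And>i. i \<in> I \<Longrightarrow> ft_isometric (f i)) \<Longrightarrow> ft_isometric (\<lambda>x. \<Sum>i\<in>I. f i x)"
  by (induction I rule: finite_induct) (simp_all add: ft_isometric_0 ft_isometric_add)

text \<open>
  The Bessel inequality for the differences turns convergence in $L^2$ into convergence of the
  transforms in $L^2$.
\<close>

lemma ft_isometric_limit:
  assumes p: "\<And>k::nat. ft_isometric (f k)"
    and g: "integrable lborel g" and g2: "square_integrable lborel g"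
    and lim: "(\<lambda>k. norm2 lborel (\<lambda>x. f k x - g x)) \<longlonglongrightarrow> 0"
  shows "ft_isometric g"
proof -
  have f: "integrable lborel (f k)" "square_integrable lborel (f k)"
    "norm2 lborel (ft (f k)) = norm2 lborel (f k)" for k
    using p by (auto simp: ft_isometric_def)
  have le: "norm (norm2 lborel (\<lambda>\<xi>. ft (f k) \<xi> - ft g \<xi>)) \<le> norm2 lborel (\<lambda>x. f k x - g x)" for k
  proof -
    have "(\<lambda>\<xi>. ft (f k) \<xi> - ft g \<xi>) = ft (\<lambda>x. f k x - g x)"
      by (intro ext) (simp add: ft_diff f g)
    then show ?thesis
      using ft_square_integrable(2)[OF _ square_integrable_diff[OF f(2)[of k] g2]] f(1)[of k] g by simp
  qed
  have l2: "(\<lambda>k. norm2 lborel (\<lambda>\<xi>. ft (f k) \<xi> - ft g \<xi>)) \<longlonglongrightarrow> 0"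
    by (rule Lim_null_comparison[OF _ lim]) (rule always_eventually, rule allI, rule le)
  have "(\<lambda>k. norm2 lborel (ft (f k))) \<longlonglongrightarrow> norm2 lborel (ft g)"
    by (rule norm2_tendsto[OF _ _ l2]) (intro ft_square_integrable f g g2)+
  moreover have "(\<lambda>k. norm2 lborel (f k)) \<longlonglongrightarrow> norm2 lborel g"
    by (rule norm2_tendsto[OF f(2) g2 lim])
  ultimately have "norm2 lborel (ft g) = norm2 lborel g"
    unfolding f(3) by (rule LIMSEQ_unique)
  then show ?thesis using g g2 by (simp add: ft_isometric_def)
qed

text \<open>
  An open set is exhausted by the continuous cutoffs $\min(1, k \, d(x, T^c))$. They vanish off the set, so
  its indicator dominates them.
\<close>

lemma ft_isometric_indicator_open:
  assumes T: "open T" and fin: "emeasure lborel (T :: 'a::euclidean_space set) < \<infinity>"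
  shows "ft_isometric (indicator T :: 'a \<Rightarrow> complex)"
proof -
  have ne: "- T \<noteq> {}"
  proof
    assume "- T = {}" then have "T = UNIV" by auto
    then show False using fin emeasure_lborel_UNIV by simp
  qed
  define \<phi> :: "nat \<Rightarrow> 'a \<Rightarrow> complex"
    where "\<phi> k x = complex_of_real (min 1 (real k * infdist x (- T)))" for k x
  have Ts: "T \<in> sets lborel" using T by simp
  note ind = indicator_square_integrable[OF Ts fin]
  have cont: "continuous_on UNIV (\<phi> k)" for k unfolding \<phi>_def by (intro continuous_intros)
  then have meas [measurable]: "\<phi> k \<in> borel_measurable borel" for k by (rule borel_measurable_continuous_onI)
  have nonneg: "0 \<le> real k * infdist x (- T)" for k x by (simp add: infdist_nonneg)
  have le: "cmod (\<phi> k x) \<le> 1 * cmod (indicator T x)" for k x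
    using nonneg[of k x] by (cases "x \<in> T") (auto simp: \<phi>_def min_def)
  have \<phi>1: "integrable lborel (\<phi> k)" for k
    by (rule Bochner_Integration.integrable_bound[OF ind(1)]) (use le in auto)
  have \<phi>2: "square_integrable lborel (\<phi> k)" for k
    by (rule square_integrable_mono(1)[OF _ ind(2) le]) auto
  have p: "ft_isometric (\<phi> k)" for k
    unfolding ft_isometric_def
    using \<phi>1 \<phi>2 norm2_ft_continuous[OF \<phi>1 \<phi>2 cont, of k 1] nonneg[of k] by (auto simp: \<phi>_def)
  have lim: "(\<lambda>k. \<phi> k x) \<longlonglongrightarrow> indicator T x" for x
  proof (cases "x \<in> T")
    case True
    then have pos: "infdist x (- T) > 0"
      using infdist_pos_not_in_closed[of "- T" x] T ne by auto
    obtain N where N: "1 < real N * infdist x (- T)" using reals_Archimedean3[OF pos] by blast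
    have "\<phi> k x = indicator T x" if "k \<ge> N" for k
    proof -
      have "real N * infdist x (- T) \<le> real k * infdist x (- T)"
        using that pos by (intro mult_right_mono) auto
      with N True show ?thesis by (simp add: \<phi>_def)
    qed
    then have "eventually (\<lambda>k. \<phi> k x = indicator T x) sequentially"
      by (auto simp: eventually_sequentially)
    then show ?thesis by (rule tendsto_eventually)
  next
    case False
    then show ?thesis by (simp add: \<phi>_def)
  qed
  show ?thesis
  proof (rule ft_isometric_limit[OF p ind(1,2)])
    show "(\<lambda>k. norm2 lborel (\<lambda>x. \<phi> k x - indicator T x)) \<longlonglongrightarrow> 0"
    proof (rule norm2_dominated_tendsto[OF _ ind(2)])
      show "cmod (\<phi> k x) \<le> 2 * cmod (indicator T x)" for k x
        using le[of k x] norm_ge_zero[of "indicator T x :: complex"] by linarith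
    qed (use lim in auto)
  qed
qed

text \<open>
  Outer regularity: a Borel set differs from an open superset by a set of small measure, that is, by
  an indicator of small $L^2$ norm.
\<close>

lemma ft_isometric_indicator:
  assumes S: "S \<in> sets borel" and fin: "emeasure lborel (S :: 'a::euclidean_space set) < \<infinity>"
  shows "ft_isometric (indicator S :: 'a \<Rightarrow> complex)"
proof -
  have Sl: "S \<in> sets lborel" "S \<in> sets lebesgue" using S by auto
  note ind = indicator_square_integrable[OF Sl(1) fin]
  have "\<exists>T. open T \<and> S \<subseteq> T \<and> emeasure lborel (T - S) < ennreal (inverse (real (Suc k)))" for k
  proof -
    obtain T where "open T" "S \<subseteq> T" "emeasure lebesgue (T - S) < ennreal (inverse (real (Suc k)))"
      by (rule sets_lebesgue_outer_open[OF Sl(2), of "inverse (real (Suc k))"]) auto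
    moreover have "T - S \<in> sets lborel" using \<open>open T\<close> S by auto
    ultimately show ?thesis by (intro exI[of _ T]) (simp add: emeasure_completion)
  qed
  then obtain T where T: "\<And>k. open (T k)" "\<And>k. S \<subseteq> T k"
    "\<And>k. emeasure lborel (T k - S) < ennreal (inverse (real (Suc k)))" by metis
  have TS: "T k - S \<in> sets lborel" for k using T(1) S by auto
  have finTS: "emeasure lborel (T k - S) < \<infinity>" for k
    using less_trans[OF T(3)[of k] ennreal_less_top] by simp
  have p: "ft_isometric (indicator (T k) :: 'a \<Rightarrow> complex)" for k
  proof (rule ft_isometric_indicator_open[OF T(1)])
    have "T k = S \<union> (T k - S)" using T(2) by blast
    then have "emeasure lborel (T k) \<le> emeasure lborel S + emeasure lborel (T k - S)"
      using emeasure_subadditive[OF Sl(1) TS[of k]] by simp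
    also have "\<dots> < \<infinity>" using fin finTS by (simp add: ennreal_add_less_top)
    finally show "emeasure lborel (T k) < \<infinity>" .
  qed
  show ?thesis
  proof (rule ft_isometric_limit[OF p ind(1,2)])
    have eq: "(\<lambda>x. indicator (T k) x - indicator S x) = (indicator (T k - S) :: 'a \<Rightarrow> complex)" for k
      using T(2)[of k] by (auto simp: fun_eq_iff indicator_def)
    have "norm2 lborel (indicator (T k - S)) \<le> sqrt (inverse (real (Suc k)))" for k
    proof -
      have "(norm2 lborel (indicator (T k - S)))\<^sup>2 = measure lborel (T k - S)"
        by (rule indicator_square_integrable(3)[OF TS finTS])
      also have "\<dots> \<le> inverse (real (Suc k))"
        using T(3)[of k] by (auto simp: measure_def intro!: enn2real_leI)
      finally show ?thesis by (rule real_le_rsqrt)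
    qed
    then have le: "norm (norm2 lborel (indicator (T k - S))) \<le> sqrt (inverse (real (Suc k)))" for k
      by simp
    have "(\<lambda>k. sqrt (inverse (real (Suc k)))) \<longlonglongrightarrow> 0"
      using tendsto_real_sqrt[OF LIMSEQ_inverse_real_of_nat] by simp
    then show "(\<lambda>k. norm2 lborel (\<lambda>x. indicator (T k) x - indicator S x :: complex)) \<longlonglongrightarrow> 0"
      unfolding eq by (rule Lim_null_comparison[rotated]) (rule always_eventually, rule allI, rule le)
  qed
qed

text \<open>
  Plancherel's theorem on $L^1 \cap L^2$. Simple functions are covered by linearity, and a dominated
  sequence of simple functions converges in $L^2$.
\<close>

lemma norm2_ft:
  fixes f :: "'a::euclidean_space \<Rightarrow> complex"
  assumes f: "integrable lborel f" and f2: "square_integrable lborel f"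
  shows "norm2 lborel (ft f) = norm2 lborel f"
proof -
  have [measurable]: "f \<in> borel_measurable lborel" using f by auto
  obtain s where s: "\<And>k::nat. simple_function lborel (s k)"
    and lim: "\<And>x. x \<in> space lborel \<Longrightarrow> (\<lambda>k. s k x) \<longlonglongrightarrow> f x"
    and le: "\<And>k x. x \<in> space lborel \<Longrightarrow> cmod (s k x) \<le> 2 * cmod (f x)"
    by (rule simple_function_approx[of f lborel]) auto
  have m [measurable]: "s k \<in> borel_measurable lborel" for k
    by (rule borel_measurable_simple_function[OF s])
  have i: "integrable lborel (s k)" for k
    by (rule Bochner_Integration.integrable_bound[where f = "\<lambda>x. 2 * f x"])
       (use le f in \<open>auto simp: norm_mult\<close>)
  have p: "ft_isometric (s k)" for k
  proof -
    have "s k = (\<lambda>x. \<Sum>c\<in>s k ` space lborel. c * indicator {y \<in> space lborel. s k y = c} x)"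
      by (intro ext simple_function_representation[OF s]) simp
    moreover have "ft_isometric (\<lambda>x. \<Sum>c\<in>s k ` space lborel. c * indicator {y \<in> space lborel. s k y = c} x)"
    proof (rule ft_isometric_sum)
      show "finite (s k ` space lborel)" by (rule simple_functionD(1)[OF s])
      show "ft_isometric (\<lambda>x. c * indicator {y \<in> space lborel. s k y = c} x)" for c
      proof (cases "c = 0")
        case False
        then show ?thesis
          using simple_function_level_finite[OF s i, of c k]
          by (intro ft_isometric_cmult ft_isometric_indicator) auto
      qed (simp add: ft_isometric_0)
    qed
    ultimately show ?thesis by simp
  qed
  have "ft_isometric f"
    by (rule ft_isometric_limit[OF p f f2]) (rule norm2_dominated_tendsto[OF m f2 le lim])
  then show ?thesis by (simp add: ft_isometric_def)
qed

lemma Lp_fun_2_iff: "Lp_fun 2 f \<longleftrightarrow> square_integrable lebesgue f"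
  by (simp add: Lp_fun_def square_integrable_def)

lemma Lp_norm_2_eq: "Lp_norm 2 f = norm2 lebesgue f"
  by (simp add: Lp_norm_def norm2_def powr_half_sqrt)

lemma Lp_fun_1_iff: "Lp_fun 1 f \<longleftrightarrow> integrable lebesgue f"
  unfolding Lp_fun_def using integrable_norm_iff[of f lebesgue] by (auto)

lemma completion_ex_borel_measurable_complex:
  fixes f :: "'a \<Rightarrow> complex"
  assumes [measurable]: "f \<in> borel_measurable (completion M)"
  obtains g where "g \<in> borel_measurable M" "AE x in completion M. f x = g x"
proof -
  have "(\<lambda>x. Re (f x)) \<in> borel_measurable (completion M)" "(\<lambda>x. Im (f x)) \<in> borel_measurable (completion M)"
    by measurable
  then obtain r i where [measurable]: "r \<in> borel_measurable M" "i \<in> borel_measurable M"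
    and ae: "AE x in M. Re (f x) = r x" "AE x in M. Im (f x) = i x"
    using completion_ex_borel_measurable_real by metis
  have "AE x in completion M. Re (f x) = r x" "AE x in completion M. Im (f x) = i x"
    using ae by (auto intro: AE_completion)
  then have "AE x in completion M. f x = Complex (r x) (i x)"
    by eventually_elim (simp add: complex_eq_iff)
  moreover have "(\<lambda>x. Complex (r x) (i x)) \<in> borel_measurable M"
    unfolding Complex_eq by measurable
  ultimately show ?thesis by (rule that[rotated])
qed

lemma fourier_integral_eq:
  "fourier_integral f \<xi> = (LINT x|lebesgue. f x * cis (- (2 * pi * (x \<bullet> \<xi>))))"
  by (simp add: fourier_integral_def cis_conv_exp mult_ac)

lemma integrable_fourier_kernel:
  fixes f :: "real ^ 'n \<Rightarrow> complex"
  assumes f: "integrable lebesgue f"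
  shows "integrable lebesgue (\<lambda>x. f x * cis (- (2 * pi * (x \<bullet> \<xi>))))"
proof (rule Bochner_Integration.integrable_bound[OF f])
  have [measurable]: "f \<in> borel_measurable lebesgue" using f by auto
  have [measurable]: "(\<lambda>x. cis (- (2 * pi * (x \<bullet> \<xi>)))) \<in> borel_measurable lebesgue"
    by (rule measurable_completion) measurable
  show "(\<lambda>x. f x * cis (- (2 * pi * (x \<bullet> \<xi>)))) \<in> borel_measurable lebesgue" by measurable
qed (auto simp: norm_mult)

lemma norm_fourier_integral_le: "cmod (fourier_integral f \<xi>) \<le> (LINT x|lebesgue. cmod (f x))"
  unfolding fourier_integral_eq
  using integral_norm_bound[of lebesgue "\<lambda>x. f x * cis (- (2 * pi * (x \<bullet> \<xi>)))"]
  by (simp add: norm_mult)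

lemma fourier_integral_diff:
  assumes "integrable lebesgue f" "integrable lebesgue g"
  shows "fourier_integral (\<lambda>x. f x - g x) \<xi> = fourier_integral f \<xi> - fourier_integral g \<xi>"
  unfolding fourier_integral_eq left_diff_distrib
  by (intro Bochner_Integration.integral_diff integrable_fourier_kernel assms)

lemma fourier_integral_sum:
  assumes "\<And>i. i \<in> I \<Longrightarrow> integrable lebesgue (f i)"
  shows "fourier_integral (\<lambda>x. \<Sum>i\<in>I. a i * f i x) \<xi> = (\<Sum>i\<in>I. a i * fourier_integral (f i) \<xi>)"
proof -
  have "fourier_integral (\<lambda>x. \<Sum>i\<in>I. a i * f i x) \<xi>
      = (LINT x|lebesgue. (\<Sum>i\<in>I. a i * (f i x * cis (- (2 * pi * (x \<bullet> \<xi>))))))"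
    unfolding fourier_integral_eq by (simp add: sum_distrib_right mult.assoc)
  also have "\<dots> = (\<Sum>i\<in>I. LINT x|lebesgue. a i * (f i x * cis (- (2 * pi * (x \<bullet> \<xi>)))))"
    by (intro Bochner_Integration.integral_sum integrable_mult_right integrable_fourier_kernel assms)
  finally show ?thesis unfolding fourier_integral_eq by (simp only: integral_mult_right_zero)
qed

text \<open>
  Lebesgue measurable functions agree almost everywhere with Borel functions, and none of the
  integrals involved notices the difference.
\<close>

lemma plancherel_lebesgue:
  fixes f :: "real ^ 'n \<Rightarrow> complex"
  assumes f: "integrable lebesgue f" and f2: "square_integrable lebesgue f"
  shows "square_integrable lebesgue (fourier_integral f)"
    and "norm2 lebesgue (fourier_integral f) = norm2 lebesgue f"
proof -
  have fm [measurable]: "f \<in> borel_measurable lebesgue" using f by auto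
  obtain g where g: "g \<in> borel_measurable lborel" and ae: "AE x in lebesgue. f x = g x"
    using completion_ex_borel_measurable_complex[OF fm] by blast
  note [measurable] = g
  have gl [measurable]: "g \<in> borel_measurable lebesgue" using g by (rule measurable_completion)
  have [measurable]: "(\<lambda>x. cis (- (2 * pi * (x \<bullet> \<xi>)))) \<in> borel_measurable lebesgue" for \<xi> :: "real ^ 'n"
    by (rule measurable_completion) measurable
  have ft: "fourier_integral f = ft g"
  proof
    fix \<xi>
    have "fourier_integral f \<xi> = (LINT x|lebesgue. g x * cis (- (2 * pi * (x \<bullet> \<xi>))))"
      unfolding fourier_integral_eq
      by (rule integral_cong_AE) (use ae in \<open>auto elim!: eventually_mono\<close>)
    also have "\<dots> = ft g \<xi>" unfolding ft_def by (rule integral_completion) measurable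
    finally show "fourier_integral f \<xi> = ft g \<xi>" .
  qed
  have "integrable lebesgue g" using f integrable_cong_AE[OF fm gl ae] by simp
  then have gi: "integrable lborel g" using integrable_completion[OF g] by simp
  have m2: "(\<lambda>x. (cmod (f x))\<^sup>2) \<in> borel_measurable lebesgue" "(\<lambda>x. (cmod (g x))\<^sup>2) \<in> borel_measurable lebesgue"
    "(\<lambda>x. (cmod (g x))\<^sup>2) \<in> borel_measurable lborel" by measurable
  have ae2: "AE x in lebesgue. (cmod (f x))\<^sup>2 = (cmod (g x))\<^sup>2" using ae by eventually_elim simp
  have "integrable lborel (\<lambda>x. (cmod (g x))\<^sup>2)"
    using square_integrableD[OF f2] integrable_cong_AE[OF m2(1,2) ae2] integrable_completion[OF m2(3)] by simp
  then have g2: "square_integrable lborel g" by (simp add: square_integrable_def)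
  have n: "norm2 lebesgue f = norm2 lborel g"
    unfolding norm2_def using integral_cong_AE[OF m2(1,2) ae2] integral_completion[OF m2(3)] by simp
  have h: "square_integrable lborel (ft g)" by (rule ft_square_integrable(1)[OF gi g2])
  note [measurable] = square_integrable_measurable[OF h]
  have m3: "(\<lambda>x. (cmod (ft g x))\<^sup>2) \<in> borel_measurable lborel" by measurable
  show "square_integrable lebesgue (fourier_integral f)"
    unfolding ft square_integrable_def
    using integrable_completion[OF m3] square_integrableD[OF h] measurable_completion[OF square_integrable_measurable[OF h]]
    by simp
  have "norm2 lebesgue (ft g) = norm2 lborel (ft g)"
    unfolding norm2_def using integral_completion[OF m3] by simp
  then show "norm2 lebesgue (fourier_integral f) = norm2 lebesgue f"
    unfolding ft n using norm2_ft[OF gi g2] by simp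
qed

section \<open>The extension of the Fourier transform to square-integrable functions\<close>

lemma is_fourier_L2D:
  assumes "is_fourier_L2 f F"
  shows "square_integrable lebesgue f" "square_integrable lebesgue F"
  using assms by (auto simp: is_fourier_L2_def Lp_fun_2_iff)

lemma is_fourier_L2_iff:
  "is_fourier_L2 f F \<longleftrightarrow> square_integrable lebesgue f \<and> square_integrable lebesgue F \<and>
     (\<exists>\<phi>. (\<forall>k::nat. integrable lebesgue (\<phi> k) \<and> square_integrable lebesgue (\<phi> k)) \<and>
          (\<lambda>k. norm2 lebesgue (\<lambda>x. \<phi> k x - f x)) \<longlonglongrightarrow> 0 \<and>
          (\<lambda>k. norm2 lebesgue (\<lambda>\<xi>. fourier_integral (\<phi> k) \<xi> - F \<xi>)) \<longlonglongrightarrow> 0)"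
  by (simp add: is_fourier_L2_def Lp_fun_2_iff Lp_fun_1_iff Lp_norm_2_eq)

lemma is_fourier_L2E:
  assumes "is_fourier_L2 f F"
  obtains \<phi> where "\<And>k::nat. integrable lebesgue (\<phi> k)" "\<And>k. square_integrable lebesgue (\<phi> k)"
    "(\<lambda>k. norm2 lebesgue (\<lambda>x. \<phi> k x - f x)) \<longlonglongrightarrow> 0"
    "(\<lambda>k. norm2 lebesgue (\<lambda>\<xi>. fourier_integral (\<phi> k) \<xi> - F \<xi>)) \<longlonglongrightarrow> 0"
  using assms unfolding is_fourier_L2_iff by (elim conjE exE) (rule that, auto)

lemma norm2_fourier_integral_diff:
  fixes f g :: "real ^ 'n \<Rightarrow> complex"
  assumes "integrable lebesgue f" "square_integrable lebesgue f"
    "integrable lebesgue g" "square_integrable lebesgue g"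
  shows "norm2 lebesgue (\<lambda>\<xi>. fourier_integral f \<xi> - fourier_integral g \<xi>) = norm2 lebesgue (\<lambda>x. f x - g x)"
proof -
  have "(\<lambda>\<xi>. fourier_integral f \<xi> - fourier_integral g \<xi>) = fourier_integral (\<lambda>x. f x - g x)"
    by (intro ext) (simp add: fourier_integral_diff assms)
  then show ?thesis
    using plancherel_lebesgue(2)[OF _ square_integrable_diff[OF assms(2,4)]] assms by simp
qed

lemma is_fourier_L2_fourier_integral:
  fixes f :: "real ^ 'n \<Rightarrow> complex"
  assumes "integrable lebesgue f" "square_integrable lebesgue f"
  shows "is_fourier_L2 f (fourier_integral f)"
  unfolding is_fourier_L2_iff
  using assms plancherel_lebesgue(1)[OF assms]
  by (intro conjI exI[of _ "\<lambda>_. f"]) (auto simp: norm2_def)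

text \<open>
  The transforms of simple functions that converge rapidly to $f$ form a rapidly Cauchy sequence,
  by Plancherel's theorem.
\<close>

lemma is_fourier_L2_exists:
  fixes f :: "real ^ 'n \<Rightarrow> complex"
  assumes f: "square_integrable lebesgue f"
  shows "\<exists>F. is_fourier_L2 f F"
proof -
  obtain s where s: "\<And>k::nat. integrable lebesgue (s k)" "\<And>k. square_integrable lebesgue (s k)"
    and lim: "(\<lambda>k. norm2 lebesgue (\<lambda>x. s k x - f x)) \<longlonglongrightarrow> 0"
    by (rule square_integrable_simple_approx[OF f]) blast
  have "\<exists>k. norm2 lebesgue (\<lambda>x. s k x - f x) < (1/2) ^ Suc j" for j
    using order_tendstoD(2)[OF lim, of "(1/2) ^ Suc j"] by (auto simp: eventually_sequentially)
  then obtain r where r: "\<And>j. norm2 lebesgue (\<lambda>x. s (r j) x - f x) < (1/2) ^ Suc j" by metis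
  have FI: "square_integrable lebesgue (fourier_integral (s (r j)))" for j
    by (rule plancherel_lebesgue(1)[OF s])
  have "norm2 lebesgue (\<lambda>\<xi>. fourier_integral (s (r (Suc j))) \<xi> - fourier_integral (s (r j)) \<xi>) \<le> (1/2) ^ j" for j
  proof -
    have "norm2 lebesgue (\<lambda>x. s (r (Suc j)) x - s (r j) x)
        \<le> norm2 lebesgue (\<lambda>x. s (r (Suc j)) x - f x) + norm2 lebesgue (\<lambda>x. f x - s (r j) x)"
      by (rule norm2_triangle3[OF s(2) f s(2)])
    also have "\<dots> \<le> (1/2) ^ j"
    proof -
      have "0 < (1/2 :: real) ^ j" by simp
      with r[of j] r[of "Suc j"] norm2_diff_commute[of lebesgue f "s (r j)"] show ?thesis
        unfolding power_Suc by linarith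
    qed
    finally show ?thesis by (simp add: norm2_fourier_integral_diff s)
  qed
  then obtain F where F: "square_integrable lebesgue F"
    "(\<lambda>j. norm2 lebesgue (\<lambda>\<xi>. fourier_integral (s (r j)) \<xi> - F \<xi>)) \<longlonglongrightarrow> 0"
    by (rule norm2_complete[of lebesgue "\<lambda>j. fourier_integral (s (r j))", OF FI]) blast+
  have le: "norm (norm2 lebesgue (\<lambda>x. s (r j) x - f x)) \<le> (1/2) ^ Suc j" for j
    using less_imp_le[OF r[of j]] by simp
  have "(\<lambda>j. (1/2 :: real) ^ Suc j) \<longlonglongrightarrow> 0" by (intro LIMSEQ_Suc LIMSEQ_power_zero) simp
  then have "(\<lambda>j. norm2 lebesgue (\<lambda>x. s (r j) x - f x)) \<longlonglongrightarrow> 0"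
    by (rule Lim_null_comparison[rotated]) (rule always_eventually, rule allI, rule le)
  then show ?thesis
    unfolding is_fourier_L2_iff using f F s by (intro exI[of _ F] conjI exI[of _ "\<lambda>j. s (r j)"]) auto
qed

text \<open>
  The choice operator in the definition of the transform always picks an admissible value, and on
  $L^1 \cap L^2$ the Fourier integral is itself admissible.
\<close>

lemma is_fourier_L2_fourier:
  fixes f :: "real ^ 'n \<Rightarrow> complex"
  assumes f: "square_integrable lebesgue f"
  shows "is_fourier_L2 f (fourier f)"
proof (cases "Lp_fun 1 f")
  case True
  then show ?thesis
    using is_fourier_L2_fourier_integral[OF _ f] by (simp add: fourier_def Lp_fun_1_iff)
next
  case False
  then show ?thesis
    using someI_ex[OF is_fourier_L2_exists[OF f]] by (simp add: fourier_def)
qed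

text \<open>
  The witnessing sequence in the definition may be exchanged for any other one with the same limit,
  which allows simple functions dominated by $f$ to be used.
\<close>

lemma is_fourier_L2_approx:
  fixes f :: "real ^ 'n \<Rightarrow> complex"
  assumes F: "is_fourier_L2 f F"
    and s: "\<And>k::nat. integrable lebesgue (s k)" "\<And>k. square_integrable lebesgue (s k)"
    and lim: "(\<lambda>k. norm2 lebesgue (\<lambda>x. s k x - f x)) \<longlonglongrightarrow> 0"
  shows "(\<lambda>k. norm2 lebesgue (\<lambda>\<xi>. fourier_integral (s k) \<xi> - F \<xi>)) \<longlonglongrightarrow> 0"
proof -
  note f2 = is_fourier_L2D[OF F]
  obtain \<phi> where \<phi>: "\<And>k::nat. integrable lebesgue (\<phi> k)" "\<And>k. square_integrable lebesgue (\<phi> k)"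
    and l1: "(\<lambda>k. norm2 lebesgue (\<lambda>x. \<phi> k x - f x)) \<longlonglongrightarrow> 0"
    and l2: "(\<lambda>k. norm2 lebesgue (\<lambda>\<xi>. fourier_integral (\<phi> k) \<xi> - F \<xi>)) \<longlonglongrightarrow> 0"
    by (rule is_fourier_L2E[OF F]) blast
  have le: "norm (norm2 lebesgue (\<lambda>\<xi>. fourier_integral (s k) \<xi> - F \<xi>))
      \<le> norm2 lebesgue (\<lambda>x. s k x - f x) + norm2 lebesgue (\<lambda>x. \<phi> k x - f x)
        + norm2 lebesgue (\<lambda>\<xi>. fourier_integral (\<phi> k) \<xi> - F \<xi>)" for k
  proof -
    have "norm2 lebesgue (\<lambda>\<xi>. fourier_integral (s k) \<xi> - F \<xi>)
        \<le> norm2 lebesgue (\<lambda>\<xi>. fourier_integral (s k) \<xi> - fourier_integral (\<phi> k) \<xi>)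
          + norm2 lebesgue (\<lambda>\<xi>. fourier_integral (\<phi> k) \<xi> - F \<xi>)"
      by (intro norm2_triangle3 plancherel_lebesgue s \<phi> f2)
    moreover have "norm2 lebesgue (\<lambda>\<xi>. fourier_integral (s k) \<xi> - fourier_integral (\<phi> k) \<xi>)
        = norm2 lebesgue (\<lambda>x. s k x - \<phi> k x)"
      by (rule norm2_fourier_integral_diff[OF s \<phi>])
    moreover have "\<dots> \<le> norm2 lebesgue (\<lambda>x. s k x - f x) + norm2 lebesgue (\<lambda>x. f x - \<phi> k x)"
      by (rule norm2_triangle3[OF s(2) f2(1) \<phi>(2)])
    moreover have "norm2 lebesgue (\<lambda>x. f x - \<phi> k x) = norm2 lebesgue (\<lambda>x. \<phi> k x - f x)"
      by (rule norm2_diff_commute)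
    ultimately show ?thesis by simp
  qed
  show ?thesis
    by (rule Lim_null_comparison[OF _ tendsto_add_zero[OF tendsto_add_zero[OF lim l1] l2]])
       (rule always_eventually, rule allI, rule le)
qed

lemma is_fourier_L2_norm2:
  fixes f :: "real ^ 'n \<Rightarrow> complex"
  assumes F: "is_fourier_L2 f F"
  shows "norm2 lebesgue F = norm2 lebesgue f"
proof -
  note f2 = is_fourier_L2D[OF F]
  obtain \<phi> where \<phi>: "\<And>k::nat. integrable lebesgue (\<phi> k)" "\<And>k. square_integrable lebesgue (\<phi> k)"
    and l1: "(\<lambda>k. norm2 lebesgue (\<lambda>x. \<phi> k x - f x)) \<longlonglongrightarrow> 0"
    and l2: "(\<lambda>k. norm2 lebesgue (\<lambda>\<xi>. fourier_integral (\<phi> k) \<xi> - F \<xi>)) \<longlonglongrightarrow> 0"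
    by (rule is_fourier_L2E[OF F]) blast
  have "(\<lambda>k. norm2 lebesgue (fourier_integral (\<phi> k))) \<longlonglongrightarrow> norm2 lebesgue F"
    by (rule norm2_tendsto[OF plancherel_lebesgue(1)[OF \<phi>] f2(2) l2])
  moreover have "(\<lambda>k. norm2 lebesgue (\<phi> k)) \<longlonglongrightarrow> norm2 lebesgue f"
    by (rule norm2_tendsto[OF \<phi>(2) f2(1) l1])
  ultimately show ?thesis
    unfolding plancherel_lebesgue(2)[OF \<phi>] by (rule LIMSEQ_unique)
qed

lemma is_fourier_L2_diff:
  fixes f g :: "real ^ 'n \<Rightarrow> complex"
  assumes F: "is_fourier_L2 f F" and g: "integrable lebesgue g" "square_integrable lebesgue g"
  shows "is_fourier_L2 (\<lambda>x. f x - g x) (\<lambda>\<xi>. F \<xi> - fourier_integral g \<xi>)"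
proof -
  note f2 = is_fourier_L2D[OF F]
  obtain \<phi> where \<phi>: "\<And>k::nat. integrable lebesgue (\<phi> k)" "\<And>k. square_integrable lebesgue (\<phi> k)"
    and l1: "(\<lambda>k. norm2 lebesgue (\<lambda>x. \<phi> k x - f x)) \<longlonglongrightarrow> 0"
    and l2: "(\<lambda>k. norm2 lebesgue (\<lambda>\<xi>. fourier_integral (\<phi> k) \<xi> - F \<xi>)) \<longlonglongrightarrow> 0"
    by (rule is_fourier_L2E[OF F]) blast
  show ?thesis
    unfolding is_fourier_L2_iff
  proof (intro conjI exI[of _ "\<lambda>k x. \<phi> k x - g x"] allI)
    show "(\<lambda>k. norm2 lebesgue (\<lambda>x. \<phi> k x - g x - (f x - g x))) \<longlonglongrightarrow> 0" using l1 by simp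
    show "(\<lambda>k. norm2 lebesgue (\<lambda>\<xi>. fourier_integral (\<lambda>x. \<phi> k x - g x) \<xi> - (F \<xi> - fourier_integral g \<xi>))) \<longlonglongrightarrow> 0"
      using l2 by (simp add: fourier_integral_diff \<phi> g)
    show "integrable lebesgue (\<lambda>x. \<phi> k x - g x)" for k using \<phi> g by simp
  qed (intro square_integrable_diff f2 \<phi> g plancherel_lebesgue)+
qed

section \<open>Three lines and Riesz--Thorin interpolation\<close>

text \<open>
  The Phragmen--Lindelof device: the factor $\exp(\epsilon (z^2 - 1))$ has modulus at most 1 on the strip
  and decays as the imaginary part grows, so the maximum principle on a tall rectangle sees
  only the two vertical edges. Then $\epsilon$ tends to $0$.
\<close>

lemma three_lines:
  assumes hol: "f holomorphic_on UNIV"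
    and bd: "\<And>z. 0 \<le> Re z \<Longrightarrow> Re z \<le> 1 \<Longrightarrow> cmod (f z) \<le> B"
    and left: "\<And>z. Re z = 0 \<Longrightarrow> cmod (f z) \<le> 1"
    and right: "\<And>z. Re z = 1 \<Longrightarrow> cmod (f z) \<le> 1"
    and z: "0 \<le> Re z" "Re z \<le> 1"
  shows "cmod (f z) \<le> 1"
proof -
  define C where "C = max B 1"
  have C: "1 \<le> C" "\<And>z. 0 \<le> Re z \<Longrightarrow> Re z \<le> 1 \<Longrightarrow> cmod (f z) \<le> C"
    using bd by (force simp: C_def)+
  let ?t = "\<lambda>w. (Re w)\<^sup>2 - (Im w)\<^sup>2 - 1"
  have key: "cmod (f z) * exp (\<epsilon> * ?t z) \<le> 1" if \<epsilon>: "\<epsilon> > 0" for \<epsilon> :: real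
  proof -
    define g where "g w = f w * exp (of_real \<epsilon> * (w\<^sup>2 - 1))" for w
    have g_norm: "cmod (g w) = cmod (f w) * exp (\<epsilon> * ?t w)" for w
      by (simp add: g_def norm_mult Re_power2)
    \<comment> \<open>So tall that on the horizontal edges the factor exp (- \<epsilon> R^2) outweighs the bound C.\<close>
    define R where "R = \<bar>Im z\<bar> + 1 + sqrt (ln C / \<epsilon>)"
    have lnC: "0 \<le> ln C" using C by simp
    have R: "\<bar>Im z\<bar> < R" using lnC \<epsilon> by (simp add: R_def add_pos_nonneg)
    have "sqrt (ln C / \<epsilon>) \<le> R" by (simp add: R_def)
    then have "(sqrt (ln C / \<epsilon>))\<^sup>2 \<le> R\<^sup>2" using lnC \<epsilon> by (intro power_mono) auto
    then have R2: "ln C \<le> \<epsilon> * R\<^sup>2" using lnC \<epsilon> by (simp add: field_simps)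
    define S where "S = cbox (Complex 0 (- R)) (Complex 1 R)"
    have "cmod (g z) \<le> 1"
    proof (rule maximum_modulus_frontier[where f = g and S = S and \<xi> = z])
      have holg: "g holomorphic_on UNIV" unfolding g_def by (intro holomorphic_intros hol)
      then show "g holomorphic_on interior S" by (rule holomorphic_on_subset) simp
      show "continuous_on (closure S) g"
        by (rule holomorphic_on_imp_continuous_on[OF holomorphic_on_subset[OF holg]]) simp
      show "bounded S" unfolding S_def by (rule bounded_cbox)
      show "z \<in> S" using z R by (auto simp: S_def in_cbox_complex_iff)
      fix w assume "w \<in> frontier S"
      then have w: "w \<in> S" "w \<notin> box (Complex 0 (- R)) (Complex 1 R)"
        by (auto simp: S_def frontier_def)
      then have wS: "0 \<le> Re w" "Re w \<le> 1" "\<bar>Im w\<bar> \<le> R"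
        and edge: "Re w = 0 \<or> Re w = 1 \<or> \<bar>Im w\<bar> = R"
        by (auto simp: S_def in_cbox_complex_iff in_box_complex_iff)
      have Re2: "(Re w)\<^sup>2 \<le> 1" using wS by (simp add: power_le_one)
      have t: "?t w \<le> - (Im w)\<^sup>2" using Re2 by simp
      consider "cmod (f w) \<le> 1" | "\<bar>Im w\<bar> = R" using edge left right by blast
      then show "cmod (g w) \<le> 1"
      proof cases
        case 1
        have "?t w \<le> 0" using t zero_le_power2[of "Im w"] by linarith
        then have "\<epsilon> * ?t w \<le> 0" using \<epsilon> by (simp add: mult_nonneg_nonpos)
        then have "exp (\<epsilon> * ?t w) \<le> 1" by simp
        then show ?thesis unfolding g_norm using 1 by (intro mult_le_one) auto
      next
        case 2
        have "(Im w)\<^sup>2 = R\<^sup>2" using 2 by (metis power2_abs)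
        then have "?t w \<le> - R\<^sup>2" using t by simp
        then have "\<epsilon> * ?t w \<le> \<epsilon> * - R\<^sup>2" using \<epsilon> by (intro mult_left_mono) auto
        then have "\<epsilon> * ?t w \<le> - ln C" using R2 by linarith
        then have "exp (\<epsilon> * ?t w) \<le> exp (- ln C)" by simp
        also have "\<dots> = inverse C" using C by (simp add: exp_minus)
        finally have "cmod (g w) \<le> C * inverse C"
          unfolding g_norm using C(2)[OF wS(1,2)] C(1) by (intro mult_mono) auto
        then show ?thesis using C(1) by simp
      qed
    qed
    then show ?thesis by (simp add: g_norm)
  qed
  have "(\<lambda>k. cmod (f z) * exp (inverse (real (Suc k)) * ?t z)) \<longlonglongrightarrow> cmod (f z) * exp (0 * ?t z)"
    by (intro tendsto_mult tendsto_const tendsto_exp LIMSEQ_inverse_real_of_nat)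
  then have "cmod (f z) * exp (0 * ?t z) \<le> 1"
    by (rule LIMSEQ_le_const2) (use key in auto)
  then show ?thesis by simp
qed

text \<open>
  The analytic family of Riesz--Thorin interpolation, applied to values of functions. Its modulus is
  $|c|^{p(1 - \mathrm{Re}\, z/2)}$: it turns the $p$-th power integral of a function into an $L^1$ norm on the
  line $\mathrm{Re}\, z = 0$ and into a squared $L^2$ norm on the line $\mathrm{Re}\, z = 1$, and it is the
  identity at $z = 2 - 2/p$. At $c = 0$ the factor \<open>sgn c\<close> makes the value $0$.
\<close>

definition power_family :: "real \<Rightarrow> complex \<Rightarrow> complex \<Rightarrow> complex" where
  "power_family p z c = sgn c * exp (of_real p * (1 - z / 2) * of_real (ln (cmod c)))"

lemma norm_power_family: "cmod (power_family p z c) = cmod c powr (p * (1 - Re z / 2))"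
  by (cases "c = 0") (simp_all add: power_family_def norm_mult norm_sgn powr_def mult.commute)

lemma power_family_id:
  assumes "0 < p" shows "power_family p (of_real (2 - 2 / p)) c = c"
proof (cases "c = 0")
  case False
  have "complex_of_real p * (1 - of_real (2 - 2 / p) / 2) = 1"
    using assms by (simp add: field_simps)
  then have "power_family p (of_real (2 - 2 / p)) c = sgn c * of_real (exp (ln (cmod c)))"
    by (simp add: power_family_def exp_of_real)
  also have "\<dots> = c" using False by (simp add: sgn_eq)
  finally show ?thesis .
qed (simp add: power_family_def)

lemma power_family_holomorphic: "(\<lambda>z. power_family p z c) holomorphic_on A"
  unfolding power_family_def by (intro holomorphic_intros) auto

lemma norm_power_family_le:
  assumes "0 < p" "0 \<le> Re z" "Re z \<le> 1"
  shows "cmod (power_family p z c) \<le> (1 + cmod c) powr p"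
proof -
  have "cmod c powr (p * (1 - Re z / 2)) \<le> (1 + cmod c) powr (p * (1 - Re z / 2))"
    using assms by (intro powr_mono2) auto
  also have "\<dots> \<le> (1 + cmod c) powr p"
    using assms by (intro powr_mono) (auto simp: mult_le_cancel_left1)
  finally show ?thesis by (simp only: norm_power_family)
qed

text \<open>
  The level set of the value 0 may have infinite measure; its indicator is replaced by 0, which
  changes no linear combination in which the value 0 has coefficient 0.
\<close>

definition level_indicator :: "('a \<Rightarrow> complex) \<Rightarrow> complex \<Rightarrow> 'a \<Rightarrow> complex" where
  "level_indicator s c x = (if c = 0 then 0 else indicator {y. s y = c} x)"

lemma level_indicator_integrable:
  fixes s :: "real ^ 'n \<Rightarrow> complex"
  assumes s: "simple_function lebesgue s" and i: "integrable lebesgue s"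
  shows "integrable lebesgue (level_indicator s c)" "square_integrable lebesgue (level_indicator s c)"
proof -
  have "integrable lebesgue (level_indicator s c) \<and> square_integrable lebesgue (level_indicator s c)"
  proof (cases "c = 0")
    case True
    then have "level_indicator s c = (\<lambda>x. 0)" by (simp add: level_indicator_def[abs_def])
    then show ?thesis by (simp add: square_integrable_def)
  next
    case False
    then have "level_indicator s c = indicator {y. s y = c}" by (simp add: level_indicator_def[abs_def])
    then show ?thesis
      using simple_function_level_finite[OF s i False] indicator_square_integrable[of "{y. s y = c}" lebesgue]
      by simp
  qed
  then show "integrable lebesgue (level_indicator s c)" "square_integrable lebesgue (level_indicator s c)" by auto
qed

lemma power_family_simple:
  fixes s :: "real ^ 'n \<Rightarrow> complex"
  assumes s: "simple_function lebesgue s"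
  shows "(\<lambda>x. power_family p z (s x)) = (\<lambda>x. \<Sum>c\<in>range s. power_family p z c * level_indicator s c x)"
proof
  fix x
  have fin: "finite (range s)" using simple_functionD(1)[OF s] by simp
  have "(\<Sum>c\<in>range s. power_family p z c * level_indicator s c x)
      = (\<Sum>c\<in>range s. if c = s x then power_family p z c else 0)"
    by (intro sum.cong refl) (auto simp: level_indicator_def power_family_def)
  then show "power_family p z (s x) = (\<Sum>c\<in>range s. power_family p z c * level_indicator s c x)"
    using fin by (simp add: sum.delta)
qed

text \<open>
  The bound $Q$ may exceed the product of the two integrals. This keeps the normalizing factor
  $Q^{-(1 - z/2)}$ meaningful when that product is $0$.
\<close>

lemma riesz_thorin_simple:
  fixes s t :: "real ^ 'n \<Rightarrow> complex"
  assumes s: "simple_function lebesgue s" "integrable lebesgue s"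
    and t: "simple_function lebesgue t" "integrable lebesgue t"
    and p: "1 \<le> p" "p \<le> 2" and Q: "0 < Q"
    and le: "(LINT x|lebesgue. cmod (s x) powr p) * (LINT x|lebesgue. cmod (t x) powr p) \<le> Q"
  shows "cmod (LINT \<xi>|lebesgue. fourier_integral s \<xi> * t \<xi>) \<le> Q powr (1 / p)"
proof -
  have p0: "0 < p" using p by simp
  define I where "I = (LINT x|lebesgue. cmod (s x) powr p)"
  define J where "J = (LINT x|lebesgue. cmod (t x) powr p)"
  have IJ: "0 \<le> I" "0 \<le> J" "I * J \<le> Q" using le by (simp_all add: I_def J_def)
  define S where "S z x = power_family p z (s x)" for z x
  define T where "T z x = power_family p z (t x)" for z x
  have fin: "finite (range s)" "finite (range t)"
    using simple_functionD(1)[OF s(1)] simple_functionD(1)[OF t(1)] by auto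
  have S_eq: "S z = (\<lambda>x. \<Sum>c\<in>range s. power_family p z c * level_indicator s c x)"
    and T_eq: "T z = (\<lambda>x. \<Sum>d\<in>range t. power_family p z d * level_indicator t d x)" for z
    unfolding S_def T_def by (rule power_family_simple[OF s(1)], rule power_family_simple[OF t(1)])
  note Es = level_indicator_integrable[OF s] and Et = level_indicator_integrable[OF t]
  have Si: "integrable lebesgue (S z)" and Ti: "integrable lebesgue (T z)" for z
    unfolding S_eq T_eq using Es Et by auto
  have S2: "square_integrable lebesgue (S z)" and T2: "square_integrable lebesgue (T z)" for z
    unfolding S_eq T_eq using fin Es Et by (auto intro!: square_integrable_sum square_integrable_cmult)
  define \<Phi> where "\<Phi> z = (LINT \<xi>|lebesgue. fourier_integral (S z) \<xi> * T z \<xi>)" for z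
  define K where "K c d = (LINT \<xi>|lebesgue. fourier_integral (level_indicator s c) \<xi> * level_indicator t d \<xi>)" for c d
  have \<Phi>_eq: "\<Phi> z = (\<Sum>c\<in>range s. \<Sum>d\<in>range t. power_family p z c * power_family p z d * K c d)" for z
  proof -
    have FS: "fourier_integral (S z) \<xi> = (\<Sum>c\<in>range s. power_family p z c * fourier_integral (level_indicator s c) \<xi>)" for \<xi>
      unfolding S_eq by (rule fourier_integral_sum) (rule Es)
    have "\<Phi> z = (LINT \<xi>|lebesgue. (\<Sum>c\<in>range s. \<Sum>d\<in>range t.
        (power_family p z c * power_family p z d) * (fourier_integral (level_indicator s c) \<xi> * level_indicator t d \<xi>)))"
      unfolding \<Phi>_def FS T_eq sum_product
      by (intro Bochner_Integration.integral_cong sum.cong refl) (simp add: mult_ac)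
    also have "\<dots> = (\<Sum>c\<in>range s. \<Sum>d\<in>range t. (LINT \<xi>|lebesgue.
        (power_family p z c * power_family p z d) * (fourier_integral (level_indicator s c) \<xi> * level_indicator t d \<xi>)))"
      by (subst Bochner_Integration.integral_sum;
          (intro Bochner_Integration.integrable_sum sum.cong refl Bochner_Integration.integral_sum)?;
          intro integrable_mult_right Cauchy_Schwarz_integral(1) plancherel_lebesgue(1) Es Et)
    finally show ?thesis unfolding K_def by simp
  qed
  have "\<Phi> holomorphic_on UNIV"
    unfolding \<Phi>_eq[abs_def] by (intro holomorphic_intros power_family_holomorphic)
  then have hol: "(\<lambda>z. \<Phi> z * exp (- (1 - z / 2) * of_real (ln Q))) holomorphic_on UNIV"
    by (intro holomorphic_intros) auto
  have wt: "cmod (exp (- (1 - z / 2) * of_real (ln Q))) = Q powr (- (1 - Re z / 2))" for z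
    using Q by (simp add: powr_def)
  define f where "f z = \<Phi> z * exp (- (1 - z / 2) * of_real (ln Q))" for z
  have f_norm: "cmod (f z) = cmod (\<Phi> z) * Q powr (- (1 - Re z / 2))" for z
    by (simp only: f_def norm_mult wt)
  let ?B = "\<Sum>c\<in>range s. \<Sum>d\<in>range t. (1 + cmod c) powr p * (1 + cmod d) powr p * cmod (K c d)"
  have \<Phi>_bd: "cmod (\<Phi> z) \<le> ?B" if "0 \<le> Re z" "Re z \<le> 1" for z
    unfolding \<Phi>_eq
    by (intro order_trans[OF norm_sum] sum_mono)
       (auto simp: norm_mult intro!: mult_mono norm_power_family_le p0 that)
  have f_bd: "cmod (f z) \<le> ?B * max 1 (1 / Q)" if "0 \<le> Re z" "Re z \<le> 1" for z
  proof -
    have "Q powr (- (1 - Re z / 2)) \<le> max 1 (1 / Q)"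
    proof (cases "Q \<le> 1")
      case True
      then have "Q powr (- (1 - Re z / 2)) \<le> Q powr (- 1)" using that Q by (intro powr_mono') auto
      then show ?thesis using Q by (simp add: powr_minus_divide)
    next
      case False
      then have "Q powr (- (1 - Re z / 2)) \<le> Q powr 0" using that by (intro powr_mono) auto
      then show ?thesis using Q by simp
    qed
    then show ?thesis unfolding f_norm
      by (intro mult_mono \<Phi>_bd that) (auto intro!: sum_nonneg)
  qed
  \<comment> \<open>On this line: the transform is bounded by the L1 norm.\<close>
  have left: "cmod (f z) \<le> 1" if "Re z = 0" for z
  proof -
    have nS: "cmod (S z x) = cmod (s x) powr p" and nT: "cmod (T z x) = cmod (t x) powr p" for x
      using that by (simp_all add: S_def T_def norm_power_family)
    have "cmod (\<Phi> z) \<le> (LINT \<xi>|lebesgue. cmod (fourier_integral (S z) \<xi> * T z \<xi>))"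
      unfolding \<Phi>_def by (rule integral_norm_bound)
    also have "\<dots> \<le> (LINT \<xi>|lebesgue. I * cmod (T z \<xi>))"
    proof (rule integral_mono')
      show "integrable lebesgue (\<lambda>\<xi>. I * cmod (T z \<xi>))" using Ti by auto
      show "cmod (fourier_integral (S z) \<xi> * T z \<xi>) \<le> I * cmod (T z \<xi>)" for \<xi>
        using norm_fourier_integral_le[of "S z" \<xi>] by (simp add: norm_mult nS I_def mult_right_mono)
    qed (use IJ in auto)
    also have "\<dots> = I * J" by (simp add: nT J_def)
    also have "\<dots> \<le> Q" by (rule IJ)
    finally show ?thesis unfolding f_norm using that Q by (simp add: powr_minus_divide)
  qed
  \<comment> \<open>On this line: Cauchy--Schwarz and Plancherel.\<close>
  have right: "cmod (f z) \<le> 1" if "Re z = 1" for z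
  proof -
    have sq: "(cmod c powr (p / 2))\<^sup>2 = cmod c powr p" for c :: complex
      by (simp add: power2_eq_square powr_add[symmetric])
    have nS: "norm2 lebesgue (S z) = sqrt I" and nT: "norm2 lebesgue (T z) = sqrt J"
      using that by (simp_all add: norm2_def S_def T_def norm_power_family sq I_def J_def)
    have "cmod (\<Phi> z) \<le> norm2 lebesgue (fourier_integral (S z)) * norm2 lebesgue (T z)"
      unfolding \<Phi>_def by (intro Cauchy_Schwarz_integral(3) plancherel_lebesgue Si S2 T2)
    also have "\<dots> = sqrt (I * J)"
      by (simp add: plancherel_lebesgue(2)[OF Si S2] nS nT real_sqrt_mult)
    also have "\<dots> \<le> Q powr (1 / 2)" using IJ Q by (simp add: powr_half_sqrt)
    finally have "cmod (f z) \<le> Q powr (1 / 2) * Q powr (- (1 / 2))"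
      unfolding f_norm using that by (simp add: mult_right_mono)
    then show ?thesis using Q by (simp add: powr_add[symmetric])
  qed
  have \<theta>: "0 \<le> 2 - 2 / p" "2 - 2 / p \<le> 1" using p by (simp_all add: field_simps)
  have "cmod (f (of_real (2 - 2 / p))) \<le> 1"
    by (rule three_lines[OF hol[folded f_def] f_bd left right]) (use \<theta> in auto)
  moreover have "1 - Re (complex_of_real (2 - 2 / p)) / 2 = 1 / p" using p0 by (simp add: field_simps)
  moreover have "S (of_real (2 - 2 / p)) = s" "T (of_real (2 - 2 / p)) = t"
    unfolding S_def T_def by (simp_all only: power_family_id[OF p0])
  ultimately have "cmod (LINT \<xi>|lebesgue. fourier_integral s \<xi> * t \<xi>) * Q powr (- (1 / p)) \<le> 1"
    unfolding f_norm \<Phi>_def by metis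
  then show ?thesis using Q by (simp add: powr_minus_divide field_simps)
qed

section \<open>A restricted Hausdorff--Young inequality\<close>

text \<open>
  Both arguments are approximated by simple functions, with convergence in $L^2$ for the pairing and
  convergence of the $p$-th power integrals for the bound. The latter are perturbed by $1/(k+1)$ to
  stay positive.
\<close>

lemma hausdorff_young_pairing:
  fixes u v :: "real ^ 'n \<Rightarrow> complex"
  assumes U: "is_fourier_L2 u U" and u: "integrable lebesgue (\<lambda>x. cmod (u x) powr p)"
    and v2: "square_integrable lebesgue v" and v: "integrable lebesgue (\<lambda>x. cmod (v x) powr p)"
    and p: "1 \<le> p" "p \<le> 2"
  shows "cmod (LINT \<xi>|lebesgue. U \<xi> * v \<xi>)
    \<le> ((LINT x|lebesgue. cmod (u x) powr p) * (LINT x|lebesgue. cmod (v x) powr p)) powr (1 / p)"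
proof -
  note u2 = is_fourier_L2D(1)[OF U] and U2 = is_fourier_L2D(2)[OF U]
  obtain s where s: "\<And>k::nat. simple_function lebesgue (s k)" "\<And>k. integrable lebesgue (s k)"
    "\<And>k. square_integrable lebesgue (s k)"
    and s_lim: "\<And>x. x \<in> space lebesgue \<Longrightarrow> (\<lambda>k. s k x) \<longlonglongrightarrow> u x"
    and s_le: "\<And>k x. x \<in> space lebesgue \<Longrightarrow> cmod (s k x) \<le> 2 * cmod (u x)"
    and s_n: "(\<lambda>k. norm2 lebesgue (\<lambda>x. s k x - u x)) \<longlonglongrightarrow> 0"
    by (rule square_integrable_simple_approx[OF u2]) blast
  obtain t where t: "\<And>k::nat. simple_function lebesgue (t k)" "\<And>k. integrable lebesgue (t k)"
    "\<And>k. square_integrable lebesgue (t k)"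
    and t_lim: "\<And>x. x \<in> space lebesgue \<Longrightarrow> (\<lambda>k. t k x) \<longlonglongrightarrow> v x"
    and t_le: "\<And>k x. x \<in> space lebesgue \<Longrightarrow> cmod (t k x) \<le> 2 * cmod (v x)"
    and t_n: "(\<lambda>k. norm2 lebesgue (\<lambda>x. t k x - v x)) \<longlonglongrightarrow> 0"
    by (rule square_integrable_simple_approx[OF v2]) blast
  let ?I = "\<lambda>f :: real ^ 'n \<Rightarrow> complex. LINT x|lebesgue. cmod (f x) powr p"
  have lim: "(\<lambda>k. cmod (LINT \<xi>|lebesgue. fourier_integral (s k) \<xi> * t k \<xi>))
      \<longlonglongrightarrow> cmod (LINT \<xi>|lebesgue. U \<xi> * v \<xi>)"
    by (intro tendsto_norm inner2_tendsto[OF plancherel_lebesgue(1)[OF s(2,3)] U2 t(3) v2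
          is_fourier_L2_approx[OF U s(2,3) s_n] t_n])
  have Is: "(\<lambda>k. ?I (s k)) \<longlonglongrightarrow> ?I u"
    using p by (intro powr_integral_tendsto[OF _ _ u _ s_lim s_le] square_integrable_measurable s u2) auto
  have It: "(\<lambda>k. ?I (t k)) \<longlonglongrightarrow> ?I v"
    using p by (intro powr_integral_tendsto[OF _ _ v _ t_lim t_le] square_integrable_measurable t v2) auto
  have Q: "(\<lambda>k. ?I (s k) * ?I (t k) + inverse (real (Suc k))) \<longlonglongrightarrow> ?I u * ?I v + 0"
    by (rule tendsto_add[OF tendsto_mult[OF Is It] LIMSEQ_inverse_real_of_nat])
  have pos: "0 \<le> ?I (s k) * ?I (t k)" for k by simp
  have "(\<lambda>k. (?I (s k) * ?I (t k) + inverse (real (Suc k))) powr (1 / p)) \<longlonglongrightarrow> (?I u * ?I v + 0) powr (1 / p)"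
    using p pos by (intro tendsto_powr' Q tendsto_const) (auto intro!: always_eventually add_nonneg_nonneg)
  then have "cmod (LINT \<xi>|lebesgue. U \<xi> * v \<xi>) \<le> (?I u * ?I v + 0) powr (1 / p)"
  proof (rule LIMSEQ_le[OF lim], intro exI allI impI)
    fix k
    show "cmod (LINT \<xi>|lebesgue. fourier_integral (s k) \<xi> * t k \<xi>)
        \<le> (?I (s k) * ?I (t k) + inverse (real (Suc k))) powr (1 / p)"
      by (rule riesz_thorin_simple[OF s(1,2) t(1,2) p]) (use pos[of k] in \<open>auto intro: add_nonneg_pos\<close>)
  qed
  then show ?thesis by simp
qed

text \<open>
  Let $X$ be the squared norm to be estimated and $e = \|u\|_p$. Pairing $\hat u$ with its own truncated
  conjugate $v$ gives $X \le e \|v\|_p$. Since $|v| > e$ on its support and $p \le 2$, also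
  $\|v\|_p^p \le e^{p-2} X$. Together $X^{p-1} \le e^{2(p-1)}$; this step needs $p > 1$.
\<close>

lemma weak_hausdorff_young:
  fixes u :: "real ^ 'n \<Rightarrow> complex"
  assumes U: "is_fourier_L2 u U" and u: "integrable lebesgue (\<lambda>x. cmod (u x) powr p)"
    and p: "1 < p" "p \<le> 2"
  shows "norm2 lebesgue (\<lambda>\<xi>. if cmod (U \<xi>) > Lp_norm p u then U \<xi> else 0) \<le> Lp_norm p u"
proof -
  note u2 = is_fourier_L2D(1)[OF U] and U2 = is_fourier_L2D(2)[OF U]
  note [measurable] = square_integrable_measurable[OF U2]
  define I where "I = (LINT x|lebesgue. cmod (u x) powr p)"
  define e where "e = Lp_norm p u"
  have I0: "0 \<le> I" by (simp add: I_def)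
  have e_eq: "e = I powr (1 / p)" by (simp add: e_def Lp_norm_def I_def)
  define V where "V \<xi> = (if cmod (U \<xi>) > e then U \<xi> else 0)" for \<xi>
  have [measurable]: "V \<in> borel_measurable lebesgue" unfolding V_def by measurable
  have VU: "cmod (V \<xi>) \<le> 1 * cmod (U \<xi>)" for \<xi> by (simp add: V_def)
  have V2: "square_integrable lebesgue V" "norm2 lebesgue V \<le> norm2 lebesgue U"
    using square_integrable_mono[OF _ U2 VU] by auto
  define X where "X = (LINT \<xi>|lebesgue. (cmod (V \<xi>))\<^sup>2)"
  have nX: "norm2 lebesgue V = sqrt X" by (simp add: norm2_def X_def)
  have X0: "0 \<le> X" by (simp add: X_def)
  have "norm2 lebesgue V \<le> e"
  proof (cases "I = 0")
    case True
    then have "norm2 lebesgue u = 0" using norm2_eq_0_if_powr[OF u] by (simp add: I_def)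
    then show ?thesis using V2(2) is_fourier_L2_norm2[OF U] by (simp add: e_eq True)
  next
    case False
    with I0 have Ipos: "0 < I" by simp
    then have epos: "0 < e" by (simp add: e_eq)
    have I_e: "I = e powr p" using p Ipos by (simp add: e_eq powr_powr)
    have Vp: "cmod (V \<xi>) powr p \<le> e powr (p - 2) * (cmod (V \<xi>))\<^sup>2" for \<xi>
    proof (cases "cmod (U \<xi>) > e")
      case True
      have pos: "0 < cmod (U \<xi>)" by (rule less_trans[OF epos True])
      have "cmod (U \<xi>) powr p = cmod (U \<xi>) powr (p - 2) * (cmod (U \<xi>))\<^sup>2"
        using pos by (simp add: powr_diff del: zero_less_norm_iff)
      also have "\<dots> \<le> e powr (p - 2) * (cmod (U \<xi>))\<^sup>2"
        using True epos p by (intro mult_right_mono powr_mono2') simp_all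
      finally show ?thesis using True by (simp add: V_def)
    qed (simp add: V_def)
    have iV: "integrable lebesgue (\<lambda>\<xi>. e powr (p - 2) * (cmod (V \<xi>))\<^sup>2)"
      using square_integrableD[OF V2(1)] by simp
    have Vi: "integrable lebesgue (\<lambda>\<xi>. cmod (V \<xi>) powr p)"
      by (rule Bochner_Integration.integrable_bound[OF iV]) (use Vp in auto)
    have VX: "(LINT \<xi>|lebesgue. cmod (V \<xi>) powr p) \<le> e powr (p - 2) * X"
      using integral_mono[OF Vi iV Vp] by (simp add: X_def)
    have "complex_of_real X = (LINT \<xi>|lebesgue. U \<xi> * cnj (V \<xi>))"
      unfolding X_def integral_complex_of_real[symmetric]
      by (intro Bochner_Integration.integral_cong refl) (simp add: V_def complex_norm_square del: of_real_power)
    then have "X = cmod (LINT \<xi>|lebesgue. U \<xi> * cnj (V \<xi>))" using X0 by (metis norm_of_real abs_of_nonneg)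
    also have "\<dots> \<le> (I * (LINT \<xi>|lebesgue. cmod (cnj (V \<xi>)) powr p)) powr (1 / p)"
      unfolding I_def
      by (rule hausdorff_young_pairing[OF U u square_integrable_cnj(1)[OF V2(1)]]) (use Vi p in auto)
    also have "\<dots> \<le> (I * (e powr (p - 2) * X)) powr (1 / p)"
      using VX Ipos p by (intro powr_mono2 mult_left_mono) auto
    finally have le: "X \<le> (e powr (2 * p - 2) * X) powr (1 / p)"
      using epos by (simp add: I_e powr_add[symmetric] mult.assoc[symmetric])
    have "X \<le> e\<^sup>2"
    proof (cases "X = 0")
      case False
      with X0 have Xpos: "0 < X" by simp
      have "X powr p \<le> ((e powr (2 * p - 2) * X) powr (1 / p)) powr p"
        using le Xpos p by (intro powr_mono2) auto
      also have "\<dots> = e powr (2 * p - 2) * X" using Xpos p by (simp add: powr_powr)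
      finally have "X powr (p - 1) * X \<le> e powr (2 * p - 2) * X"
        using Xpos by (simp add: powr_diff)
      then have "X powr (p - 1) \<le> e powr (2 * p - 2)" using Xpos by simp
      then have "(X powr (p - 1)) powr (1 / (p - 1)) \<le> (e powr (2 * p - 2)) powr (1 / (p - 1))"
        using p by (intro powr_mono2) auto
      moreover have "(2 * p - 2) * (1 / (p - 1)) = 2" using p by (simp add: field_simps)
      ultimately have "X \<le> e powr 2" using Xpos p by (simp add: powr_powr)
      then show ?thesis using epos by simp
    qed simp
    then show ?thesis unfolding nX using epos by (intro real_le_lsqrt) auto
  qed
  then show ?thesis unfolding V_def e_def .
qed

section \<open>Stability of the Fourier modulus\<close>

text \<open>
  The three cases of the argument at a single frequency. The quantity \<open>b\<close> is unaffected by
  the convention for $F = 0$, since division by zero yields zero.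
\<close>

lemma pointwise_decomposition:
  fixes F G :: complex
  defines "b \<equiv> Im (cnj F * G / complex_of_real (cmod F))"
  shows "cmod (F - G) \<le> 2 * \<bar>cmod F - cmod G\<bar> + (2 * \<bar>b\<bar> +
    (sqrt 8 * cmod (if cmod F \<le> 10 * e then F else 0) + cmod (if cmod (F - G) > e then F - G else 0)))"
proof -
  have s8: "2 \<le> sqrt 8" by (intro real_le_rsqrt) simp
  consider "cmod F \<le> 10 * e" | "cmod (F - G) > e" | "cmod F > 10 * e" "cmod (F - G) \<le> e" by linarith
  then show ?thesis
  proof cases
    case 1
    have "cmod (F - G) \<le> 2 * cmod F + \<bar>cmod F - cmod G\<bar>" using norm_triangle_ineq4[of F G] by linarith
    also have "2 * cmod F \<le> sqrt 8 * cmod F" using s8 by (intro mult_right_mono) auto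
    finally have "cmod (F - G) \<le> sqrt 8 * cmod F + \<bar>cmod F - cmod G\<bar>" by simp
    moreover have "0 \<le> cmod (if cmod (F - G) > e then F - G else 0)" by simp
    ultimately show ?thesis using 1 abs_ge_zero[of b] abs_ge_zero[of "cmod F - cmod G"] by (simp del: abs_ge_zero)
  next
    case 2
    have "0 \<le> sqrt 8 * cmod (if cmod F \<le> 10 * e then F else 0)" by simp
    then show ?thesis using 2 by simp
  next
    case 3
    have "0 \<le> e" using 3(2) norm_ge_zero[of "F - G"] by linarith
    then have F: "0 < cmod F" using 3 by linarith
    define z where "z = cnj F * G / complex_of_real (cmod F)"
    have z: "cnj F / complex_of_real (cmod F) * G = z" by (simp add: z_def)
    have "cnj F * F = complex_of_real ((cmod F)\<^sup>2)" by (simp only: complex_norm_square mult.commute)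
    then have zF: "cnj F / complex_of_real (cmod F) * F = complex_of_real (cmod F)"
      using F by (simp add: power2_eq_square)
    have one: "cmod (cnj F / complex_of_real (cmod F)) = 1" using F by (simp add: norm_divide)
    have nG: "cmod z = cmod G" unfolding z[symmetric] norm_mult one by simp
    have "cmod (complex_of_real (cmod F) - z) = cmod (cnj F / complex_of_real (cmod F) * (F - G))"
      unfolding right_diff_distrib zF z ..
    then have nFG: "cmod (complex_of_real (cmod F) - z) = cmod (F - G)" unfolding norm_mult one by simp
    have b: "b = Im z" by (simp add: b_def z_def)
    have "\<bar>cmod F - Re z\<bar> \<le> cmod (F - G)"
      using abs_Re_le_cmod[of "complex_of_real (cmod F) - z"] nFG by simp
    \<comment> \<open>F - G has smaller modulus than F, so G cannot point away from F.\<close>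
    then have a: "0 \<le> Re z" using 3 F by linarith
    have "cmod G \<le> \<bar>Re z\<bar> + \<bar>b\<bar>" "\<bar>Re z\<bar> \<le> cmod G"
      using cmod_le[of z] abs_Re_le_cmod[of z] by (simp_all add: nG b)
    moreover have "cmod (F - G) \<le> \<bar>cmod F - Re z\<bar> + \<bar>b\<bar>"
      using cmod_le[of "complex_of_real (cmod F) - z"] nFG by (simp add: b)
    ultimately have "cmod (F - G) \<le> \<bar>cmod F - cmod G\<bar> + 2 * \<bar>b\<bar>" using a by linarith
    also have "\<dots> \<le> 2 * \<bar>cmod F - cmod G\<bar> + 2 * \<bar>b\<bar>"
      by (intro add_right_mono) simp
    finally have "cmod (F - G) \<le> 2 * \<bar>cmod F - cmod G\<bar> + 2 * \<bar>b\<bar>" .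
    then show ?thesis using 3 by simp
  qed
qed

text \<open>
  A function in $L^1 \cap L^2$ lies in every $L^p$ between, since $t^p \le t + t^2$.
\<close>

lemma Lp_fun_diff:
  assumes f: "Lp_fun p f" and g: "Lp_fun 1 g" "Lp_fun 2 g" and p: "1 \<le> p" "p \<le> 2"
  shows "Lp_fun p (\<lambda>x. f x - g x)"
proof -
  have [measurable]: "f \<in> borel_measurable lebesgue" "g \<in> borel_measurable lebesgue"
    using f g by (auto simp: Lp_fun_def)
  have interp: "a powr p \<le> a + a\<^sup>2" if a: "0 \<le> a" for a :: real
  proof (cases "a \<le> 1")
    case True
    then have "a powr p \<le> a powr 1" using a p by (intro powr_mono') auto
    also have "\<dots> \<le> a + a\<^sup>2" using a by simp
    finally show ?thesis .
  next
    case False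
    then have "a powr p \<le> a powr 2" using p by (intro powr_mono) auto
    also have "\<dots> \<le> a + a\<^sup>2" using a by simp
    finally show ?thesis .
  qed
  have le: "cmod (f x - g x) powr p \<le> 2 powr p * (cmod (f x) powr p + (cmod (g x) + (cmod (g x))\<^sup>2))" for x
  proof -
    have "cmod (f x - g x) \<le> 2 * max (cmod (f x)) (cmod (g x))"
      using norm_triangle_ineq4[of "f x" "g x"] by linarith
    then have "cmod (f x - g x) powr p \<le> (2 * max (cmod (f x)) (cmod (g x))) powr p"
      using p by (intro powr_mono2) auto
    also have "\<dots> = 2 powr p * (max (cmod (f x)) (cmod (g x))) powr p"
      by (simp add: powr_mult le_max_iff_disj)
    also have "(max (cmod (f x)) (cmod (g x))) powr p \<le> cmod (f x) powr p + cmod (g x) powr p"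
      by (simp add: max_def)
    also have "cmod (g x) powr p \<le> cmod (g x) + (cmod (g x))\<^sup>2" by (rule interp) simp
    finally show ?thesis by simp
  qed
  have "integrable lebesgue (\<lambda>x. 2 powr p * (cmod (f x) powr p + (cmod (g x) + (cmod (g x))\<^sup>2)))"
    using f g by (auto simp: Lp_fun_def)
  then have "integrable lebesgue (\<lambda>x. cmod (f x - g x) powr p)"
    by (rule Bochner_Integration.integrable_bound) (use le in auto)
  then show ?thesis by (simp add: Lp_fun_def)
qed

theorem mainTheorem1:
  fixes p :: real and f :: "real ^ 'n \<Rightarrow> complex"
  assumes "1 \<le> p" and "p < 2"
    and "Lp_fun p f" and "Lp_fun 2 f"
  shows "\<forall>g :: real ^ 'n \<Rightarrow> complex. Lp_fun 1 g \<and> Lp_fun 2 g \<longrightarrow>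
    Lp_norm 2 (\<lambda>x. f x - g x)
      \<le> 2 * Lp_norm 2 (\<lambda>\<xi>. complex_of_real (norm (fourier f \<xi>) - norm (fourier g \<xi>)))
        + h_fun p f (Lp_norm p (\<lambda>x. f x - g x))
        + 2 * Lp_norm 2 (\<lambda>\<xi>. complex_of_real (Im_part (fourier f) (fourier g) \<xi>))"
proof (intro allI impI, elim conjE)
  fix g :: "real ^ 'n \<Rightarrow> complex"
  assume g: "Lp_fun 1 g" "Lp_fun 2 g"
  define F where "F = fourier f"
  define G where "G = fourier g"
  define H where "H = (\<lambda>\<xi>. F \<xi> - G \<xi>)"
  define e where "e = Lp_norm p (\<lambda>x. f x - g x)"
  have f2: "square_integrable lebesgue f" and g1: "integrable lebesgue g" and g2: "square_integrable lebesgue g"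
    using assms g by (simp_all add: Lp_fun_1_iff Lp_fun_2_iff)
  have G_eq: "G = fourier_integral g" using g by (simp add: G_def fourier_def)
  have FF: "is_fourier_L2 f F" unfolding F_def by (rule is_fourier_L2_fourier[OF f2])
  have HH: "is_fourier_L2 (\<lambda>x. f x - g x) H" unfolding H_def G_eq by (rule is_fourier_L2_diff[OF FF g1 g2])
  have F2: "square_integrable lebesgue F" by (rule is_fourier_L2D(2)[OF FF])
  have G2: "square_integrable lebesgue G" unfolding G_eq by (rule plancherel_lebesgue(1)[OF g1 g2])
  have H2: "square_integrable lebesgue H" by (rule is_fourier_L2D(2)[OF HH])
  note [measurable] = square_integrable_measurable[OF F2] square_integrable_measurable[OF G2]
    square_integrable_measurable[OF H2]
  have fg: "Lp_fun p (\<lambda>x. f x - g x)" by (rule Lp_fun_diff) (use assms g in auto)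
  define D where "D = (\<lambda>\<xi>. complex_of_real (cmod (F \<xi>) - cmod (G \<xi>)))"
  have Im_eq: "Im_part F G = (\<lambda>\<xi>. Im (cnj (F \<xi>) * G \<xi> / complex_of_real (cmod (F \<xi>))))"
    by (auto simp: Im_part_def)
  define B where "B = (\<lambda>\<xi>. complex_of_real (Im_part F G \<xi>))"
  define L where "L = (\<lambda>\<xi>. if cmod (F \<xi>) \<le> 10 * e then F \<xi> else 0)"
  define W where "W = (\<lambda>\<xi>. if cmod (H \<xi>) > e then H \<xi> else 0)"
  have Dm: "D \<in> borel_measurable lebesgue" unfolding D_def by measurable
  have Bm: "B \<in> borel_measurable lebesgue" unfolding B_def Im_eq by measurable
  have Lm: "L \<in> borel_measurable lebesgue" unfolding L_def by measurable
  have Wm: "W \<in> borel_measurable lebesgue" unfolding W_def by measurable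
  have D2: "square_integrable lebesgue D"
    by (rule square_integrable_mono(1)[OF Dm H2, of 1])
       (simp_all add: D_def H_def norm_triangle_ineq3 del: of_real_diff)
  have B2: "square_integrable lebesgue B"
  proof (rule square_integrable_mono(1)[OF Bm G2, of 1])
    fix \<xi>
    have "cmod (B \<xi>) \<le> cmod (cnj (F \<xi>) * G \<xi> / complex_of_real (cmod (F \<xi>)))"
      unfolding B_def Im_eq norm_of_real by (rule abs_Im_le_cmod)
    also have "\<dots> \<le> cmod (G \<xi>)" by (simp add: norm_mult norm_divide)
    finally show "cmod (B \<xi>) \<le> 1 * cmod (G \<xi>)" by simp
  qed simp
  have L2: "square_integrable lebesgue L"
    by (rule square_integrable_mono(1)[OF Lm F2, of 1]) (simp_all add: L_def)
  have W2: "square_integrable lebesgue W"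
    by (rule square_integrable_mono(1)[OF Wm H2, of 1]) (simp_all add: W_def)
  define r where "r = complex_of_real (sqrt 8)"
  have "norm2 lebesgue H \<le> norm2 lebesgue (\<lambda>\<xi>. 2 * D \<xi>) + (norm2 lebesgue (\<lambda>\<xi>. 2 * B \<xi>)
      + (norm2 lebesgue (\<lambda>\<xi>. r * L \<xi>) + norm2 lebesgue W))"
  proof -
    note D2' = square_integrable_cmult(1)[OF D2, of 2]
      and B2' = square_integrable_cmult(1)[OF B2, of 2]
      and L2' = square_integrable_cmult(1)[OF L2, of r]
    \<comment> \<open>Minkowski's inequality is applied three times; h1 and h2 carry the sums of moduli that remain to be split.\<close>
    define h1 where "h1 = (\<lambda>\<xi>. complex_of_real (cmod (r * L \<xi>) + cmod (W \<xi>)))"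
    define h2 where "h2 = (\<lambda>\<xi>. complex_of_real (cmod (2 * B \<xi>) + cmod (h1 \<xi>)))"
    have h1m [measurable]: "h1 \<in> borel_measurable lebesgue" unfolding h1_def using Lm Wm by measurable
    have h2m: "h2 \<in> borel_measurable lebesgue" unfolding h2_def using Bm by measurable
    have c1: "cmod (h1 \<xi>) = cmod (r * L \<xi>) + cmod (W \<xi>)" for \<xi>
      unfolding h1_def norm_of_real by simp
    have c2: "cmod (h2 \<xi>) = cmod (2 * B \<xi>) + cmod (h1 \<xi>)" for \<xi>
      unfolding h2_def norm_of_real by simp
    note b1 = norm2_add_bound[OF h1m L2' W2 eq_refl[OF c1]]
    note b2 = norm2_add_bound[OF h2m B2' b1(1) eq_refl[OF c2]]
    have "cmod (H \<xi>) \<le> cmod (2 * D \<xi>) + cmod (h2 \<xi>)" for \<xi>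
    proof -
      have e1: "cmod (2 * D \<xi>) = 2 * \<bar>cmod (F \<xi>) - cmod (G \<xi>)\<bar>" by (simp add: D_def norm_mult del: of_real_diff)
      have e2: "cmod (2 * B \<xi>) = 2 * \<bar>Im (cnj (F \<xi>) * G \<xi> / complex_of_real (cmod (F \<xi>)))\<bar>"
        by (simp only: B_def Im_eq norm_mult norm_of_real norm_numeral)
      have e3: "cmod (r * L \<xi>) = sqrt 8 * cmod (L \<xi>)" by (simp add: r_def norm_mult)
      show ?thesis
        unfolding c2 c1 e1 e2 e3 unfolding L_def W_def H_def by (rule pointwise_decomposition)
    qed
    from norm2_add_bound(2)[OF square_integrable_measurable[OF H2] D2' b2(1) this] b1(2) b2(2)
    show ?thesis by linarith
  qed
  also have "\<dots> = 2 * norm2 lebesgue D + 2 * norm2 lebesgue B + (sqrt 8 * norm2 lebesgue L + norm2 lebesgue W)"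
    by (simp add: square_integrable_cmult(2) D2 B2 L2 r_def)
  also have "sqrt 8 * norm2 lebesgue L + norm2 lebesgue W \<le> h_fun p f e"
  proof -
    have "(LINT \<xi>:{\<xi>. norm (F \<xi>) \<le> 10 * e}|lebesgue. (norm (F \<xi>))\<^sup>2) = (norm2 lebesgue L)\<^sup>2"
      unfolding norm2_squared set_lebesgue_integral_def L_def
      by (intro Bochner_Integration.integral_cong refl) (auto simp: indicator_def)
    then have 1: "sqrt (8 * (LINT \<xi>:{\<xi>. norm (F \<xi>) \<le> 10 * e}|lebesgue. (norm (F \<xi>))\<^sup>2))
        = sqrt 8 * norm2 lebesgue L" by (simp add: real_sqrt_mult)
    have 2: "norm2 lebesgue W \<le> (if p > 1 then e else 0)"
    proof (cases "p > 1")
      case True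
      have "norm2 lebesgue W \<le> e"
        unfolding W_def e_def
        by (rule weak_hausdorff_young[OF HH _ True]) (use fg assms in \<open>auto simp: Lp_fun_def\<close>)
      with True show ?thesis by simp
    next
      case False
      then have p1: "p = 1" using assms by simp
      then have f1: "integrable lebesgue f" using assms by (simp add: Lp_fun_1_iff)
      have F_eq: "F = fourier_integral f" using f1 by (simp add: F_def fourier_def Lp_fun_1_iff)
      have le: "cmod (H \<xi>) \<le> e" for \<xi>
      proof -
        have "H \<xi> = fourier_integral (\<lambda>x. f x - g x) \<xi>"
          unfolding H_def F_eq G_eq by (simp add: fourier_integral_diff f1 g1)
        then show ?thesis using norm_fourier_integral_le[of "\<lambda>x. f x - g x" \<xi>]
          by (simp add: e_def Lp_norm_def p1)
      qed
      have "W = (\<lambda>\<xi>. 0)" by (intro ext) (simp only: W_def not_less[THEN iffD2, OF le] if_False)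
      then show ?thesis by (simp add: norm2_def p1)
    qed
    from 1 2 show ?thesis unfolding h_fun_def F_def[symmetric] by simp
  qed
  finally have main: "norm2 lebesgue H \<le> 2 * norm2 lebesgue D + 2 * norm2 lebesgue B + h_fun p f e" by simp
  have "Lp_norm 2 (\<lambda>x. f x - g x) = norm2 lebesgue H"
    unfolding Lp_norm_2_eq by (rule is_fourier_L2_norm2[OF HH, symmetric])
  then show "Lp_norm 2 (\<lambda>x. f x - g x)
      \<le> 2 * Lp_norm 2 (\<lambda>\<xi>. complex_of_real (norm (fourier f \<xi>) - norm (fourier g \<xi>)))
        + h_fun p f (Lp_norm p (\<lambda>x. f x - g x))
        + 2 * Lp_norm 2 (\<lambda>\<xi>. complex_of_real (Im_part (fourier f) (fourier g) \<xi>))"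
    using main unfolding Lp_norm_2_eq e_def[symmetric] F_def[symmetric] G_def[symmetric]
      D_def B_def by linarith
qed

end
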